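(* Let $\theta\in\mathbb{R}^m$ be fixed. Let $(\hat\theta_t)_{t\ge 0}$ be defined by $$\hat\theta_t=\hat\theta_{t-1}+\Gamma_t^{-1}(\hat\theta_{t-1})\,\psi_t(\hat\theta_{t-1}),\qquad t\ge 1,$$ with initial point $\hat\theta_0\in\mathbb{R}^m$, and for $u\in\mathbb{R}^m$ put $b_t(\theta,u)=E_\theta\{\psi_t(\theta+u)\mid\mathcal{F}_{t-1}\}$, $t\ge1$. Suppose that: (C1) $u^{T}\Gamma_t^{-1}(\theta+u)\,b_t(\theta,u)<0$ for each $u\neq 0$ and each $t\ge 1$, $P^\theta$-a.s., where the exceptional set of $P^\theta$-probability $0$ does not depend on $u$; (C2) for each $\varepsilon\in(0,1)$, $$\sum_{t=1}^\infty\ \inf_{\varepsilon\le\|u\|\le 1/\varepsilon}\left|u^{T}\Gamma_t^{-1}(\theta+u)\,b_t(\theta,u)\right|=\infty,\qquad P^\theta\text{-a.s.};$$ (C3) there exists a predictable scalar process $(B_t^\theta)_{t\ge1}$ such that for each $t\ge 1$ $$E_\theta\left\{\|\Gamma_t^{-1}(\theta+u)\psi_t(\theta+u)\|^2\mid\mathcal{F}_{t-1}\right\}\le B_t^\theta(1+\|u\|^2)$$ for each $u\in\mathbb{R}^m$, $P^\theta$-a.s. (with exceptional set of $P^\theta$-probability $0$ not depending on $u$), and $\sum_{t=1}^\infty B_t^\theta<\infty$, $P^\theta$-a.s. Then $\hat\theta_t$ is strongly consistent, i.e. $\hat\theta_t\to\theta$ $P^\theta$-a.s., for any initial value $\ha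t\theta_0\in\mathbb{R}^m$.
   Context: Setting. $X_1,X_2,\dots$ are observations taking values in a measurable space $(\mathbf{X},\mathcal{B}(\mathbf{X}))$ equipped with a $\sigma$-finite measure $\mu$, defined on $(\Omega,\mathcal{F})$ with a family of probability measures $\{P^\theta:\theta\in\mathbb{R}^m\}$. For each $t\ge1$ there is, under $P^\theta$, a regular conditional probability density (w.r.t. $\mu$) $f_t(\theta,x_t\mid x_1^{t-1})=f_t(\theta,x_t\mid x_{t-1},\dots,x_1)$ of $X_t$ given the past observations ($f_1(\theta,\cdot)$ is the density of $X_1$). $\mathcal{F}_t=\sigma(X_1,\dots,X_t)$, $\mathcal{F}_0$ is the trivial $\sigma$-algebra. Conditional expectations $E_\theta\{\cdot\mid\mathcal{F}_{t-1}\}$ under $P^\theta$ are always computed as integrals w.r.t. these conditional densities, i.e. $E_\theta\{\varphi(X_t,\dots,X_1)\mid\mathcal{F}_{t-1}\}=\int\varphi(z,X_{t-1},\dots,X_1)f_t(\theta,z\mid X_1^{t-1})\mu(dz)$, and are assumed well defined. A process indexed by $t\ge 1$ is predictable if its value at time $t$ is $\mathcal{F}_{t-1}$-measurable for each $t\ge1$. For each $t\ge1$, $\psi_t:\mathbb{R}^m\times\mathbf{X}^t\to\mathbb{R}^m$ is a Borel function and $\psi_t(v)=\psi_t(v,X_t,X_{t-1},\dots,X_1)$. For each $v\in\mathbb{R}^m$, $(\Gamma_t(v))_{t\ge1}$ is a predictable process of $m\times m$ matrices with $\det\Gamma_t(v)\neq0$; $\Gamma_t(v)$ is given by a jointly measurable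 function of $(v,X_{t-1},\dots,X_1)$. $\Gamma_t^{-1}(v)$ is the inverse matrix, ${}^T$ denotes transposition and $\|\cdot\|$ is the Euclidean norm. *)

theory Defs
  imports "HOL-Probability.Probability"
begin

text \<open>
  A point of the t-fold product of the observation space is an extensional function on
  \<open>{1..t}\<close>, i.e. an element of the space of \<open>Pi\<^sub>M {1..t} (\<lambda>_. \<mu>)\<close>; for \<open>t = 0\<close> this is a
  one-point space.  Only the measurable structure of \<open>Pi\<^sub>M\<close> is used here, not its measure.
\<close>

definition history :: "(nat \<Rightarrow> 'w \<Rightarrow> 'x) \<Rightarrow> nat \<Rightarrow> 'w \<Rightarrow> (nat \<Rightarrow> 'x)"
  where "history X t \<omega> = (\<lambda>i\<in>{1..t}. X i \<omega>)"

text \<open>For \<open>t = 0\<close> the generator is empty and the sigma-algebra is trivial.\<close>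

definition obs_filtration :: "'w set \<Rightarrow> 'x measure \<Rightarrow> (nat \<Rightarrow> 'w \<Rightarrow> 'x) \<Rightarrow> nat \<Rightarrow> 'w measure"
  where "obs_filtration \<Omega> \<mu> X t =
    sigma \<Omega> (\<Union>i\<in>{1..t}. {X i -` A \<inter> \<Omega> | A. A \<in> sets \<mu>})"

text \<open>
  In \<open>f t \<theta> z h\<close> the argument \<open>z\<close> is the value of the observation at time \<open>t\<close> and \<open>h\<close> is the past
  \<open>(x\<^sub>1, \<dots>, x\<^sub>t\<^sub>-\<^sub>1)\<close>.  For \<open>t = 1\<close> the conditioning is trivial and \<open>f 1 \<theta>\<close> is the density
  of \<open>X 1\<close>.
\<close>

locale observation_model =
  fixes P :: "real ^ 'm \<Rightarrow> 'w measure"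
    and X :: "nat \<Rightarrow> 'w \<Rightarrow> 'x"
    and \<mu> :: "'x measure"
    and f :: "nat \<Rightarrow> real ^ 'm \<Rightarrow> 'x \<Rightarrow> (nat \<Rightarrow> 'x) \<Rightarrow> real"
  assumes prob_space_P: "\<And>\<theta>. prob_space (P \<theta>)"
    and sets_P: "\<And>\<theta> \<theta>'. sets (P \<theta>) = sets (P \<theta>')"
    and sigma_finite_mu: "sigma_finite_measure \<mu>"
    and measurable_X: "\<And>t \<theta>. t \<ge> 1 \<Longrightarrow> X t \<in> P \<theta> \<rightarrow>\<^sub>M \<mu>"
    and measurable_density: "\<And>t \<theta>. t \<ge> 1 \<Longrightarrow>
      (\<lambda>(z, h). f t \<theta> z h) \<in> borel_measurable (\<mu> \<Otimes>\<^sub>M Pi\<^sub>M {1..t - 1} (\<lambda>_. \<mu>))"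
    and density_nonneg: "\<And>t \<theta> z h. t \<ge> 1 \<Longrightarrow> z \<in> space \<mu> \<Longrightarrow>
      h \<in> space (Pi\<^sub>M {1..t - 1} (\<lambda>_. \<mu>)) \<Longrightarrow> 0 \<le> f t \<theta> z h"
    and density_total: "\<And>t \<theta> h. t \<ge> 1 \<Longrightarrow> h \<in> space (Pi\<^sub>M {1..t - 1} (\<lambda>_. \<mu>)) \<Longrightarrow>
      (\<integral>\<^sup>+z. ennreal (f t \<theta> z h) \<partial>\<mu>) = 1"
    and density_cond_prob: "\<And>t \<theta> A. t \<ge> 1 \<Longrightarrow> A \<in> sets \<mu> \<Longrightarrow>
      AE \<omega> in P \<theta>.
        real_cond_exp (P \<theta>) (obs_filtration (space (P \<theta>)) \<mu> X (t - 1))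
          (indicator (X t -` A \<inter> space (P \<theta>))) \<omega>
        = (LINT z:A|\<mu>. f t \<theta> z (history X (t - 1) \<omega>))"

text \<open>
  \<open>cond_E \<mu> f X \<theta> t \<phi>\<close> is the conditional expectation under \<open>P \<theta>\<close> of
  \<open>\<phi> (X\<^sub>t, \<dots>, X\<^sub>1)\<close> given the observations up to time \<open>t - 1\<close>, in the version computed
  with the conditional density.  The Bochner integral is \<open>0\<close> for a non-integrable integrand, so
  statements about \<open>cond_E\<close> are meaningful only together with \<open>cond_E_defined\<close>.
\<close>

definition cond_E ::
  "'x measure \<Rightarrow> (nat \<Rightarrow> real ^ 'm \<Rightarrow> 'x \<Rightarrow> (nat \<Rightarrow> 'x) \<Rightarrow> real) \<Rightarrow> (nat \<Rightarrow> 'w \<Rightarrow> 'x) \<Rightarrow>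
   real ^ 'm \<Rightarrow> nat \<Rightarrow> ((nat \<Rightarrow> 'x) \<Rightarrow> 'b) \<Rightarrow> 'w \<Rightarrow> 'b::{banach, second_countable_topology}"
  where "cond_E \<mu> f X \<theta> t \<phi> \<omega> =
    (LINT z|\<mu>. f t \<theta> z (history X (t - 1) \<omega>) *\<^sub>R \<phi> ((history X (t - 1) \<omega>)(t := z)))"

definition cond_E_defined ::
  "'x measure \<Rightarrow> (nat \<Rightarrow> real ^ 'm \<Rightarrow> 'x \<Rightarrow> (nat \<Rightarrow> 'x) \<Rightarrow> real) \<Rightarrow> (nat \<Rightarrow> 'w \<Rightarrow> 'x) \<Rightarrow>
   real ^ 'm \<Rightarrow> nat \<Rightarrow> ((nat \<Rightarrow> 'x) \<Rightarrow> 'b::{banach, second_countable_topology}) \<Rightarrow> 'w \<Rightarrow> bool"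
  where "cond_E_defined \<mu> f X \<theta> t \<phi> \<omega> \<longleftrightarrow>
    integrable \<mu>
      (\<lambda>z. f t \<theta> z (history X (t - 1) \<omega>) *\<^sub>R \<phi> ((history X (t - 1) \<omega>)(t := z)))"

end

theory Submission
  imports Defs
begin

text \<open>
  Let \<open>u\<^sub>t\<close> be the estimation error at time \<open>t\<close> and \<open>V\<^sub>t\<close> its squared norm.  Expanding the square in the
  recursion and conditioning on the past gives
  \<open>E[V\<^sub>t | F\<^sub>t\<^sub>-\<^sub>1] = V\<^sub>t\<^sub>-\<^sub>1 + 2 u \<bullet> (\<Gamma>\<^sup>-\<^sup>1 b) + E[norm (\<Gamma>\<^sup>-\<^sup>1 \<psi>)\<^sup>2 | F\<^sub>t\<^sub>-\<^sub>1]\<close>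
  with \<open>u = u\<^sub>t\<^sub>-\<^sub>1\<close>.  The middle term is nonpositive by the first condition, and the last one is at most
  \<open>B\<^sub>t (1 + V\<^sub>t\<^sub>-\<^sub>1)\<close> by the third.  So \<open>V\<close> is a supermartingale up to the summable relative error \<open>B\<close>, and
  the Robbins-Siegmund lemma yields that \<open>V\<^sub>t\<close> converges almost surely to a finite limit and that the
  drift terms along the path of the estimator are summable.  If the limit were positive, the error would
  remain in a shell between two positive radii, where the second condition makes the sum of the drift
  terms infinite.  Hence the limit is \<open>0\<close>.
  
  The Robbins-Siegmund lemma (\<open>robbins_siegmund\<close>) follows from Doob's convergence theorem
  for nonnegative supermartingales, which is proved by counting upcrossings.  The statement about the
  model then needs two bridges: integrals against the conditional density are conditional
  expectations in the abstract sense (\<open>nn_cond_exp_next_obs\<close>), and the estimator is a measurable function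
  of the observed history, for which the inverse matrix must depend measurably on the matrix
  (\<open>borel_measurable_matrix_inv_mult_vec\<close>).
\<close>

section \<open>Convergence of nonnegative supermartingales\<close>

text \<open>
  The counting automaton of an upcrossing of the interval from \<open>a\<close> to \<open>b\<close>: it starts climbing when
  the sequence is at or below \<open>a\<close> and stops when the sequence has reached \<open>b\<close>.  Whether it climbs after
  time \<open>n\<close> is decided by the values up to time \<open>n\<close>, so it is a predictable betting strategy for the
  increment from \<open>n\<close> to \<open>n + 1\<close>.
\<close>

primrec climbing :: "real \<Rightarrow> real \<Rightarrow> (nat \<Rightarrow> real) \<Rightarrow> nat \<Rightarrow> bool" where
  "climbing a b y 0 \<longleftrightarrow> y 0 \<le> a"
| "climbing a b y (Suc n) \<longleftrightarrow> (if climbing a b y n then y (Suc n) < b else y (Suc n) \<le> a)"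

primrec upcrossings :: "real \<Rightarrow> real \<Rightarrow> (nat \<Rightarrow> real) \<Rightarrow> nat \<Rightarrow> nat" where
  "upcrossings a b y 0 = 0"
| "upcrossings a b y (Suc n) =
    upcrossings a b y n + (if climbing a b y n \<and> b \<le> y (Suc n) then 1 else 0)"

text \<open>
  Doob's inequality in a form local in time.  Betting one unit on every increment made while climbing
  earns at least \<open>b - a\<close> per completed upcrossing plus the open position \<open>y n - a\<close>.  Since this
  potential grows in each step by no more than the gain of the bet, its expectation cannot
  increase along a supermartingale.
\<close>

lemma upcrossing_gain_step:
  assumes "a < b"
  shows "(b - a) * upcrossings a b y (Suc n) + (if climbing a b y (Suc n) then y (Suc n) - a else 0)
    \<le> (b - a) * upcrossings a b y n + (if climbing a b y n then y n - a else 0)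
      + (if climbing a b y n then y (Suc n) - y n else 0)"
  using assms by (auto simp: algebra_simps)

lemma upcrossings_le: "upcrossings a b y n \<le> n"
  by (induction n) auto

lemma upcrossings_mono: "m \<le> n \<Longrightarrow> upcrossings a b y m \<le> upcrossings a b y n"
  by (rule lift_Suc_mono_le[of "upcrossings a b y"]) auto

text \<open>
  After the last upcrossing the automaton either climbs forever, and the sequence stays below \<open>b\<close>, or
  never climbs again, and the sequence stays above \<open>a\<close>.
\<close>

lemma no_oscillation_if_upcrossings_bounded:
  assumes ab: "a < b" and bdd: "\<And>n. upcrossings a b y n \<le> K"
  shows "(\<forall>\<^sub>F n in sequentially. y n < b) \<or> (\<forall>\<^sub>F n in sequentially. a < y n)"
proof -
  define N where "N = (ARG_MAX (upcrossings a b y) n. True)"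
  have N: "upcrossings a b y n \<le> upcrossings a b y N" for n
    unfolding N_def by (rule arg_max_nat_le[where b = "Suc K"]) (auto simp: bdd less_Suc_eq_le)
  have const: "upcrossings a b y n = upcrossings a b y N" if "n \<ge> N" for n
    using N upcrossings_mono[OF that, of a b y] by (simp add: antisym)
  have stay: "\<not> (climbing a b y n \<and> b \<le> y (Suc n))" if "n \<ge> N" for n
    using const[of n] const[of "Suc n"] that by (auto split: if_splits)
  show ?thesis
  proof (cases "\<exists>n\<ge>N. climbing a b y n")
    case True
    then obtain m where m: "m \<ge> N" "climbing a b y m" by blast
    have "climbing a b y n" if "n \<ge> m" for n
      using that
    proof (induction n rule: dec_induct)
      case base then show ?case using m by simp
    next
      case (step n) then show ?case using stay[of n] m by auto
    qed
    then have "\<forall>n\<ge>m. y (Suc n) < b" using stay m by (meson le_trans not_le)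
    then have "\<forall>\<^sub>F n in sequentially. y (Suc n) < b" by (auto simp: eventually_sequentially)
    then show ?thesis using eventually_sequentially_Suc[of "\<lambda>n. y n < b"] by blast
  next
    case False
    then have "\<forall>n\<ge>N. a < y (Suc n)" by (metis climbing.simps(2) le_SucI not_le)
    then have "\<forall>\<^sub>F n in sequentially. a < y (Suc n)" by (auto simp: eventually_sequentially)
    then show ?thesis using eventually_sequentially_Suc[of "\<lambda>n. a < y n"] by blast
  qed
qed

text \<open>
  If the lower and the upper limit differed, two rational levels would fit between them, against the
  previous lemma.  Rational levels form a countable set, so that the exceptional null sets of all pairs
  of levels have a null union.
  The lower limit is taken in \<open>ennreal\<close> because this is where Fatou's lemma controls it.
\<close>

lemma convergent_if_upcrossings_bounded:
  assumes nonneg: "\<And>n. 0 \<le> y n"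
    and bdd: "\<And>a b. a \<in> \<rat> \<Longrightarrow> b \<in> \<rat> \<Longrightarrow> 0 < a \<Longrightarrow> a < b \<Longrightarrow> \<exists>K. \<forall>n. upcrossings a b y n \<le> K"
    and fin: "liminf (\<lambda>n. ennreal (y n)) \<noteq> \<infinity>"
  shows "convergent y"
proof -
  let ?l = "liminf (\<lambda>n. ereal (y n))" and ?L = "limsup (\<lambda>n. ereal (y n))"
  have l0: "0 \<le> ?l" by (rule Liminf_bounded) (auto simp: nonneg)
  have "?L \<le> ?l"
  proof (rule ccontr)
    assume "\<not> ?L \<le> ?l"
    then have "?l < ?L" by simp
    then obtain r where r: "?l < ereal r" "ereal r < ?L" by (metis ereal_dense2)
    then obtain s where s: "ereal r < ereal s" "ereal s < ?L" by (metis ereal_dense2)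
    obtain a where a: "a \<in> \<rat>" "r < a" "a < s" using Rats_dense_in_real[of r s] s by auto
    obtain b where b: "b \<in> \<rat>" "a < b" "b < s" using Rats_dense_in_real[of a s] a by auto
    have "0 < a" using l0 r a by (metis ereal_less(2) le_less_trans less_ereal.simps(1) order_less_trans)
    then obtain K where "\<And>n. upcrossings a b y n \<le> K" using bdd a b by blast
    from no_oscillation_if_upcrossings_bounded[OF \<open>a < b\<close> this] show False
    proof
      assume "\<forall>\<^sub>F n in sequentially. y n < b"
      then have "?L \<le> ereal b" by (intro Limsup_bounded) (auto elim: eventually_mono)
      then show False using s b by (metis leD less_ereal.simps(1) order_less_le_trans order_less_trans)
    next
      assume "\<forall>\<^sub>F n in sequentially. a < y n"
      then have "ereal a \<le> ?l" by (intro Liminf_bounded) (auto elim: eventually_mono)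
      then show False using r a by (metis leD less_ereal.simps(1) order_less_le_trans order_less_trans)
    qed
  qed
  then have eq: "?L = ?l" by (intro antisym Liminf_le_Limsup) auto
  have "?l \<noteq> \<infinity>"
  proof
    assume inf: "?l = \<infinity>"
    obtain N where N: "liminf (\<lambda>n. ennreal (y n)) \<le> of_nat N"
      using fin by (metis ennreal_Ex_less_of_nat less_imp_le infinity_ennreal_def top.not_eq_extremum)
    have "\<forall>\<^sub>F n in sequentially. ereal (real (Suc N)) < ereal (y n)"
      by (rule less_LiminfD) (simp add: inf)
    then have "of_nat (Suc N) \<le> liminf (\<lambda>n. ennreal (y n))"
      by (intro Liminf_bounded) (auto elim!: eventually_mono simp: ennreal_of_nat_eq_real_of_nat simp del: of_nat_Suc intro!: ennreal_leI)
    then have "(of_nat (Suc N) :: ennreal) \<le> of_nat N" using N by (rule order_trans)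
    then show False unfolding of_nat_le_iff by simp
  qed
  then obtain c where "?l = ereal c" using l0 by (cases ?l) auto
  then have "(\<lambda>n. ereal (y n)) \<longlonglongrightarrow> ereal c" using eq by (intro Liminf_eq_Limsup) auto
  then show ?thesis by (auto simp: convergent_def)
qed

lemma filtration_mono:
  assumes "\<And>n. sets (F n) \<subseteq> sets (F (Suc n))" "m \<le> n"
  shows "sets (F m) \<subseteq> sets (F n)"
  using assms by (rule lift_Suc_mono_le)

text \<open>
  Doob's convergence theorem.  By the gain inequality the expected number of upcrossings is at most
  \<open>a / (b - a)\<close>, because a nonnegative process has an open loss of at most \<open>a\<close>; so almost surely
  no pair of rational levels is crossed infinitely often.  Fatou's lemma excludes an infinite limit.
\<close>

theorem (in prob_space) nonneg_supermartingale_convergence: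
  fixes Y :: "nat \<Rightarrow> 'a \<Rightarrow> real"
  assumes sub: "\<And>n. subalgebra M (F n)"
    and mono: "\<And>n. sets (F n) \<subseteq> sets (F (Suc n))"
    and adapted: "\<And>n. Y n \<in> borel_measurable (F n)"
    and nonneg: "\<And>n x. 0 \<le> Y n x"
    and init: "(\<integral>\<^sup>+x. ennreal (Y 0 x) \<partial>M) < \<infinity>"
    and super: "\<And>n. AE x in M. nn_cond_exp M (F n) (\<lambda>x. ennreal (Y (Suc n) x)) x \<le> ennreal (Y n x)"
  shows "AE x in M. convergent (\<lambda>n. Y n x)"
proof -
  have space_F: "space (F n) = space M" for n using sub by (auto simp: subalgebra_def)
  have subF: "subalgebra (F n) (F m)" if "m \<le> n" for m n
    using filtration_mono[of F, OF mono that] space_F by (auto simp: subalgebra_def)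
  have sfs: "sigma_finite_subalgebra M (F n)" for n
    by (intro finite_measure_subalgebra_is_sigma_finite finite_measure_subalgebra.intro
        finite_measure_subalgebra_axioms.intro sub finite_measure_axioms)
  have YM[measurable]: "Y n \<in> borel_measurable M" for n
    using measurable_from_subalg[OF sub adapted] .
  have YF: "Y m \<in> borel_measurable (F n)" if "m \<le> n" for m n
    using measurable_from_subalg[OF subF[OF that] adapted] .
  have step: "(\<integral>\<^sup>+x. indicator A x * ennreal (Y (Suc n) x) \<partial>M) \<le> (\<integral>\<^sup>+x. indicator A x * ennreal (Y n x) \<partial>M)"
    if "A \<in> sets (F n)" for A n
  proof -
    have "(\<integral>\<^sup>+x. indicator A x * ennreal (Y (Suc n) x) \<partial>M)
        = (\<integral>\<^sup>+x. indicator A x * nn_cond_exp M (F n) (\<lambda>x. ennreal (Y (Suc n) x)) x \<partial>M)"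
      using that by (intro sigma_finite_subalgebra.nn_cond_exp_intg[OF sfs, symmetric]) auto
    also have "\<dots> \<le> (\<integral>\<^sup>+x. indicator A x * ennreal (Y n x) \<partial>M)"
      using super[of n] by (intro nn_integral_mono_AE) (auto elim!: eventually_mono intro: mult_left_mono)
    finally show ?thesis .
  qed
  have decr: "(\<integral>\<^sup>+x. ennreal (Y n x) \<partial>M) \<le> (\<integral>\<^sup>+x. ennreal (Y 0 x) \<partial>M)" for n
  proof (induction n)
    case (Suc n)
    have ind: "(\<integral>\<^sup>+x. ennreal (Y k x) \<partial>M) = (\<integral>\<^sup>+x. indicator (space M) x * ennreal (Y k x) \<partial>M)" for k
      by (rule nn_integral_cong) simp
    have "space M \<in> sets (F n)" using sets.top[of "F n"] by (simp only: space_F)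
    then have "(\<integral>\<^sup>+x. ennreal (Y (Suc n) x) \<partial>M) \<le> (\<integral>\<^sup>+x. ennreal (Y n x) \<partial>M)"
      unfolding ind by (rule step)
    then show ?case using Suc by simp
  qed simp
  have int[simp]: "integrable M (Y n)" for n
    using decr[of n] init by (intro integrableI_nonneg) (auto simp: nonneg)
  have fin: "AE x in M. liminf (\<lambda>n. ennreal (Y n x)) \<noteq> \<infinity>"
  proof -
    have "(\<integral>\<^sup>+x. liminf (\<lambda>n. ennreal (Y n x)) \<partial>M) \<le> liminf (\<lambda>n. \<integral>\<^sup>+x. ennreal (Y n x) \<partial>M)"
      by (rule nn_integral_liminf) auto
    also have "\<dots> \<le> (\<integral>\<^sup>+x. ennreal (Y 0 x) \<partial>M)"
      using decr by (intro Liminf_le always_eventually allI) auto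
    finally have "AE x in M. liminf (\<lambda>n. ennreal (Y n x)) \<noteq> \<infinity>"
      using init by (intro nn_integral_noteq_infinite) auto
    then show ?thesis .
  qed
  have bounded: "AE x in M. \<exists>K. \<forall>n. upcrossings a b (\<lambda>n. Y n x) n \<le> K" if ab: "0 < a" "a < b" for a b
  proof -
    \<comment> \<open>The potential of the betting strategy: completed upcrossings plus open position.\<close>
    let ?U = "\<lambda>n x. upcrossings a b (\<lambda>n. Y n x) n"
    let ?C = "\<lambda>n. {x \<in> space M. climbing a b (\<lambda>n. Y n x) n}"
    let ?\<Phi> = "\<lambda>n x. (b - a) * ?U n x + indicator (?C n) x * (Y n x - a)"
    have CF: "?C n \<in> sets (F n)" for n
    proof (induction n)
      case 0
      have "{x \<in> space (F 0). Y 0 x \<le> a} \<in> sets (F 0)" using YF[of 0 0] by measurable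
      then show ?case by (simp add: space_F)
    next
      case (Suc n)
      have C[measurable]: "?C n \<in> sets (F (Suc n))" using Suc mono by blast
      have Y[measurable]: "Y (Suc n) \<in> borel_measurable (F (Suc n))" using YF by simp
      have "?C (Suc n) = (?C n \<inter> {x \<in> space (F (Suc n)). Y (Suc n) x < b})
          \<union> ({x \<in> space (F (Suc n)). Y (Suc n) x \<le> a} - ?C n)"
        by (auto simp: space_F)
      also have "\<dots> \<in> sets (F (Suc n))" by measurable
      finally show ?case .
    qed
    have CM[measurable]: "?C n \<in> sets M" for n using CF sub by (auto simp: subalgebra_def)
    have UM[measurable]: "(\<lambda>x. real (?U n x)) \<in> borel_measurable M" for n
    proof (induction n)
      case (Suc n)
      note [measurable] = Suc
      have "(\<lambda>x. real (?U n x) + indicator (?C n) x * indicator {x \<in> space M. b \<le> Y (Suc n) x} x) \<in> borel_measurable M"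
        by measurable
      then show ?case
        by (rule measurable_cong[THEN iffD1, rotated]) (auto simp: indicator_def)
    qed simp
    have intU[simp]: "integrable M (\<lambda>x. real (?U n x))" for n
      by (rule integrable_const_bound[where B = "real n"]) (auto simp: upcrossings_le)
    have intC[simp]: "integrable M (\<lambda>x. indicator (?C n) x * g x)" if "integrable M g" for n and g :: "'a \<Rightarrow> real"
      using integrable_mult_indicator[OF CM that, of n] by simp
    have int\<Phi>: "integrable M (?\<Phi> n)" for n
      by (intro Bochner_Integration.integrable_add intC Bochner_Integration.integrable_diff
          integrable_mult_right intU int) auto
    have E\<Phi>: "(\<integral>x. ?\<Phi> n x \<partial>M) \<le> 0" for n
    proof (induction n)
      case 0
      have "(\<integral>x. ?\<Phi> 0 x \<partial>M) \<le> (\<integral>x. 0 \<partial>M)"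
        by (rule integral_mono[OF int\<Phi>]) (auto simp: indicator_def)
      then show ?case by simp
    next
      case (Suc n)
      have "(\<integral>x. ?\<Phi> (Suc n) x \<partial>M)
          \<le> (\<integral>x. ?\<Phi> n x + (indicator (?C n) x * Y (Suc n) x - indicator (?C n) x * Y n x) \<partial>M)"
      proof (rule integral_mono[OF int\<Phi>])
        show "integrable M (\<lambda>x. ?\<Phi> n x + (indicator (?C n) x * Y (Suc n) x - indicator (?C n) x * Y n x))"
          by (intro Bochner_Integration.integrable_add[OF int\<Phi>] Bochner_Integration.integrable_diff intC int)
      next
        fix x assume "x \<in> space M"
        then show "?\<Phi> (Suc n) x \<le> ?\<Phi> n x + (indicator (?C n) x * Y (Suc n) x - indicator (?C n) x * Y n x)"
          using upcrossing_gain_step[OF ab(2), of "\<lambda>n. Y n x" n] by (simp add: indicator_def split: if_splits)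
      qed
      also have "\<dots> = (\<integral>x. ?\<Phi> n x \<partial>M)
          + ((\<integral>x. indicator (?C n) x * Y (Suc n) x \<partial>M) - (\<integral>x. indicator (?C n) x * Y n x \<partial>M))"
        by (subst Bochner_Integration.integral_add[OF int\<Phi>])
          (auto intro!: Bochner_Integration.integrable_diff intC int)
      also have "(\<integral>x. indicator (?C n) x * Y (Suc n) x \<partial>M) \<le> (\<integral>x. indicator (?C n) x * Y n x \<partial>M)"
      proof -
        have eq: "ennreal (\<integral>x. indicator (?C n) x * Y k x \<partial>M) = (\<integral>\<^sup>+x. indicator (?C n) x * ennreal (Y k x) \<partial>M)" for k
        proof -
          have "(\<integral>\<^sup>+x. ennreal (indicator (?C n) x * Y k x) \<partial>M) = ennreal (\<integral>x. indicator (?C n) x * Y k x \<partial>M)"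
            by (rule nn_integral_eq_integral[OF intC[OF int]]) (simp add: nonneg)
          then show ?thesis by (simp add: ennreal_mult' nonneg ennreal_indicator)
        qed
        have "0 \<le> (\<integral>x. indicator (?C n) x * Y n x \<partial>M)" by (simp add: nonneg)
        then show ?thesis using step[OF CF[of n]] unfolding eq[symmetric] by (simp only: ennreal_le_iff)
      qed
      finally show ?case using Suc by linarith
    qed
    have EU: "(\<integral>\<^sup>+x. ennreal (?U n x) \<partial>M) \<le> ennreal (a / (b - a))" for n
    proof -
      have "(\<integral>x. (b - a) * ?U n x \<partial>M) \<le> (\<integral>x. ?\<Phi> n x + a \<partial>M)"
        using ab nonneg
        by (intro integral_mono Bochner_Integration.integrable_add[OF int\<Phi>] integrable_mult_right intU)
          (auto simp: indicator_def)
      also have "\<dots> = (\<integral>x. ?\<Phi> n x \<partial>M) + a"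
        by (subst Bochner_Integration.integral_add[OF int\<Phi>]) (auto simp: prob_space)
      finally have "(b - a) * (\<integral>x. ?U n x \<partial>M) \<le> a" using E\<Phi>[of n] by simp
      then have "(\<integral>x. ?U n x \<partial>M) \<le> a / (b - a)" using ab by (simp add: field_simps)
      then show ?thesis by (subst nn_integral_eq_integral) (auto intro: ennreal_leI)
    qed
    have "(\<integral>\<^sup>+x. (SUP n. ennreal (?U n x)) \<partial>M) = (SUP n. \<integral>\<^sup>+x. ennreal (?U n x) \<partial>M)"
      by (rule nn_integral_monotone_convergence_SUP)
        (auto simp: incseq_def le_fun_def intro!: ennreal_leI upcrossings_mono)
    also have "\<dots> \<le> ennreal (a / (b - a))" by (rule SUP_least) (rule EU)
    finally have "(\<integral>\<^sup>+x. (SUP n. ennreal (?U n x)) \<partial>M) \<noteq> \<infinity>" by (auto simp: top_unique)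
    then have "AE x in M. (SUP n. ennreal (?U n x)) \<noteq> \<infinity>"
      by (intro nn_integral_noteq_infinite) auto
    then show ?thesis
    proof eventually_elim
      case (elim x)
      then obtain K where K: "(SUP n. ennreal (?U n x)) \<le> of_nat K"
        by (metis ennreal_Ex_less_of_nat less_imp_le infinity_ennreal_def top.not_eq_extremum)
      have "?U n x \<le> K" for n
        using order_trans[OF SUP_upper[of n UNIV "\<lambda>n. ennreal (?U n x)"] K]
        by (simp add: ennreal_of_nat_eq_real_of_nat)
      then show ?case by blast
    qed
  qed
  have "AE x in M. \<forall>a\<in>\<rat>. \<forall>b\<in>\<rat>. 0 < a \<longrightarrow> a < b \<longrightarrow> (\<exists>K. \<forall>n. upcrossings a b (\<lambda>n. Y n x) n \<le> K)"
    using bounded by (intro AE_ball_countable' countable_rat) (auto simp: AE_conj_iff)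
  with fin show ?thesis
    by eventually_elim (rule convergent_if_upcrossings_bounded, auto simp: nonneg)
qed

section \<open>The Robbins-Siegmund lemma\<close>

text \<open>
  The Robbins-Siegmund lemma, with the same factor \<open>\<beta>\<close> for growth and offset, that is
  \<open>E[1 + V\<^sub>n\<^sub>+\<^sub>1 | F\<^sub>n] + \<nu>\<^sub>n \<le> (1 + \<beta>\<^sub>n) (1 + V\<^sub>n)\<close>.  Dividing by the compound growth
  \<open>p\<^sub>n\<^sub>+\<^sub>1 = (1 + \<beta>\<^sub>0) \<cdots> (1 + \<beta>\<^sub>n)\<close> removes the growth, and adding the discounted past
  decreases \<open>\<nu>\<^sub>k / p\<^sub>k\<^sub>+\<^sub>1\<close> turns the result \<open>Y\<close> into a nonnegative supermartingale.
  The process \<open>V\<close> itself may fail to be integrable since \<open>\<beta>\<close> is random, whereas \<open>Y\<close> is integrable as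
  soon as \<open>V 0\<close> is, so the supermartingale theorem applies to it on the whole space.
  Convergence of \<open>Y\<close> gives both conclusions: the sum in \<open>Y\<close> is monotone and bounded by \<open>Y\<close>, and the
  growth \<open>p\<close> has a finite limit because \<open>\<beta>\<close> is summable.
\<close>

theorem (in prob_space) robbins_siegmund:
  fixes V \<beta> \<nu> :: "nat \<Rightarrow> 'a \<Rightarrow> real"
  assumes sub: "\<And>n. subalgebra M (F n)"
    and mono: "\<And>n. sets (F n) \<subseteq> sets (F (Suc n))"
    and V_adapted: "\<And>n. V n \<in> borel_measurable (F n)"
    and \<beta>_adapted: "\<And>n. \<beta> n \<in> borel_measurable (F n)"
    and \<nu>_adapted: "\<And>n. \<nu> n \<in> borel_measurable (F n)"
    and V_nonneg: "\<And>n x. 0 \<le> V n x"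
    and \<beta>_nonneg: "\<And>n x. 0 \<le> \<beta> n x"
    and \<nu>_nonneg: "\<And>n x. 0 \<le> \<nu> n x"
    and init: "(\<integral>\<^sup>+x. ennreal (V 0 x) \<partial>M) < \<infinity>"
    and drift: "\<And>n. AE x in M. nn_cond_exp M (F n) (\<lambda>x. ennreal (V (Suc n) x)) x + ennreal (\<nu> n x)
      \<le> ennreal ((1 + \<beta> n x) * V n x + \<beta> n x)"
    and summable_\<beta>: "AE x in M. summable (\<lambda>n. \<beta> n x)"
  shows "AE x in M. convergent (\<lambda>n. V n x) \<and> summable (\<lambda>n. \<nu> n x)"
proof -
  define p where "p n x = (\<Prod>k<n. 1 + \<beta> k x)" for n x
  define S where "S n x = (\<Sum>k<n. \<nu> k x / p (Suc k) x)" for n x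
  define Y where "Y n x = (1 + V n x) / p n x + S n x" for n x
  have p1: "1 \<le> p n x" for n x
    unfolding p_def by (intro prod_ge_1) (simp add: \<beta>_nonneg)
  have p0: "0 < p n x" for n x using p1[of n x] by linarith
  have p_Suc: "p (Suc n) x = p n x * (1 + \<beta> n x)" for n x by (simp add: p_def)
  have S0: "0 \<le> S n x" for n x
    unfolding S_def by (intro sum_nonneg divide_nonneg_pos \<nu>_nonneg p0)
  have Y0: "0 \<le> Y n x" for n x
    unfolding Y_def using p0[of n x] S0[of n x] V_nonneg[of n x] by (intro add_nonneg_nonneg divide_nonneg_pos) auto
  have space_F: "space (F n) = space M" for n using sub by (auto simp: subalgebra_def)
  have subF: "subalgebra (F n) (F m)" if "m \<le> n" for m n
    using filtration_mono[of F, OF mono that] space_F by (auto simp: subalgebra_def)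
  have sfs: "sigma_finite_subalgebra M (F n)" for n
    by (intro finite_measure_subalgebra_is_sigma_finite finite_measure_subalgebra.intro
        finite_measure_subalgebra_axioms.intro sub finite_measure_axioms)
  have \<beta>F: "\<beta> k \<in> borel_measurable (F n)" if "k \<le> n" for k n
    by (rule measurable_from_subalg[OF subF[OF that] \<beta>_adapted])
  have \<nu>F: "\<nu> k \<in> borel_measurable (F n)" if "k \<le> n" for k n
    by (rule measurable_from_subalg[OF subF[OF that] \<nu>_adapted])
  have pF: "(\<lambda>x. p k x) \<in> borel_measurable (F n)" if "k \<le> Suc n" for k n
    unfolding p_def using that
    by (intro borel_measurable_prod borel_measurable_add borel_measurable_const \<beta>F) auto
  have SF: "(\<lambda>x. S k x) \<in> borel_measurable (F n)" if "k \<le> Suc n" for k n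
    unfolding S_def using that
    by (intro borel_measurable_sum borel_measurable_divide pF \<nu>F) auto
  have YF: "Y n \<in> borel_measurable (F n)" for n
    unfolding Y_def
    by (intro borel_measurable_add borel_measurable_divide borel_measurable_const V_adapted pF SF) auto
  have VM[measurable]: "V n \<in> borel_measurable M" for n
    by (rule measurable_from_subalg[OF sub V_adapted])
  have "AE x in M. convergent (\<lambda>n. Y n x)"
  proof (rule nonneg_supermartingale_convergence[where F = F and Y = Y, OF sub mono YF Y0])
    have "(\<integral>\<^sup>+x. ennreal (Y 0 x) \<partial>M) = (\<integral>\<^sup>+x. 1 + ennreal (V 0 x) \<partial>M)"
      by (rule nn_integral_cong) (simp add: Y_def p_def S_def V_nonneg)
    also have "\<dots> = 1 + (\<integral>\<^sup>+x. ennreal (V 0 x) \<partial>M)"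
      by (subst nn_integral_add) (auto simp: emeasure_space_1)
    finally show "(\<integral>\<^sup>+x. ennreal (Y 0 x) \<partial>M) < \<infinity>" using init by simp
  next
    fix n
    let ?E = "nn_cond_exp M (F n)"
    let ?q = "\<lambda>x. ennreal (1 / p (Suc n) x)" and ?c = "\<lambda>x. ennreal (1 / p (Suc n) x + S (Suc n) x)"
    let ?V = "\<lambda>x. ennreal (V (Suc n) x)"
    have qF[measurable]: "?q \<in> borel_measurable (F n)" and cF[measurable]: "?c \<in> borel_measurable (F n)"
      using pF[of "Suc n" n] SF[of "Suc n" n] by measurable
    have [measurable]: "?q \<in> borel_measurable M" "?c \<in> borel_measurable M"
      by (rule measurable_from_subalg[OF sub qF], rule measurable_from_subalg[OF sub cF])
    have eq: "(\<lambda>x. ennreal (Y (Suc n) x)) = (\<lambda>x. ?q x * ?V x + ?c x)"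
    proof
      fix x
      have "Y (Suc n) x = 1 / p (Suc n) x * V (Suc n) x + (1 / p (Suc n) x + S (Suc n) x)"
        by (simp add: Y_def add_divide_distrib)
      then show "ennreal (Y (Suc n) x) = ?q x * ?V x + ?c x"
        using p0[of "Suc n" x] S0[of "Suc n" x] V_nonneg[of "Suc n" x]
        by (simp add: ennreal_mult'[symmetric] ennreal_plus[symmetric] del: ennreal_plus)
    qed
    have a: "AE x in M. ?E (\<lambda>x. ?q x * ?V x) x + ?E ?c x = ?E (\<lambda>x. ?q x * ?V x + ?c x) x"
      by (rule sigma_finite_subalgebra.nn_cond_exp_sum[OF sfs]) measurable
    have b: "AE x in M. ?q x * ?E ?V x = ?E (\<lambda>x. ?q x * ?V x) x"
      by (rule sigma_finite_subalgebra.nn_cond_exp_prod[OF sfs]) measurable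
    have c: "AE x in M. ?c x = ?E ?c x"
      by (rule sigma_finite_subalgebra.nn_cond_exp_F_meas[OF sfs]) measurable
    show "AE x in M. ?E (\<lambda>x. ennreal (Y (Suc n) x)) x \<le> ennreal (Y n x)"
      using a b c drift[of n] unfolding eq
    proof eventually_elim
      case (elim x)
      have S_step: "?c x = ?q x * (1 + ennreal (\<nu> n x)) + ennreal (S n x)"
      proof -
        have "1 / p (Suc n) x + S (Suc n) x = 1 / p (Suc n) x * (1 + \<nu> n x) + S n x"
          by (simp add: S_def field_simps add_divide_distrib)
        then show ?thesis
          using p0[of "Suc n" x] S0[of n x] \<nu>_nonneg[of n x]
          by (simp add: ennreal_mult'[symmetric] ennreal_1[symmetric] ennreal_plus[symmetric]
              del: ennreal_plus ennreal_1)
      qed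
      have "?E (\<lambda>x. ?q x * ?V x + ?c x) x = ?q x * ?E ?V x + ?c x" using elim by simp
      also have "\<dots> = ?q x * (1 + (?E ?V x + ennreal (\<nu> n x))) + ennreal (S n x)"
        unfolding S_step by (simp add: algebra_simps)
      also have "\<dots> \<le> ?q x * (1 + ennreal ((1 + \<beta> n x) * V n x + \<beta> n x)) + ennreal (S n x)"
        using elim by (intro add_mono mult_left_mono) auto
      also have "\<dots> = ennreal (1 / p (Suc n) x * (1 + ((1 + \<beta> n x) * V n x + \<beta> n x)) + S n x)"
        using p0[of "Suc n" x] S0[of n x] V_nonneg[of n x] \<beta>_nonneg[of n x]
        by (simp add: ennreal_mult'[symmetric] ennreal_1[symmetric] ennreal_plus[symmetric]
            del: ennreal_plus ennreal_1)
      also have "1 / p (Suc n) x * (1 + ((1 + \<beta> n x) * V n x + \<beta> n x)) + S n x = Y n x"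
        using p0[of n x] \<beta>_nonneg[of n x] unfolding Y_def p_Suc by (simp add: divide_simps) (simp add: algebra_simps)
      finally show ?case .
    qed
  qed
  with summable_\<beta> show ?thesis
  proof eventually_elim
    case (elim x)
    have "convergent_prod (\<lambda>n. 1 + \<beta> n x)"
      using elim(1) \<beta>_nonneg by (intro abs_convergent_prod_imp_convergent_prod) (simp add: abs_convergent_prod_conv_summable)
    then have "convergent (\<lambda>n. \<Prod>k\<le>n. 1 + \<beta> k x)" by (rule convergent_prod_imp_convergent)
    then have "convergent (\<lambda>n. p (Suc n) x)" by (simp add: p_def lessThan_Suc_atMost)
    then have pconv: "convergent (\<lambda>n. p n x)" by (subst (asm) convergent_Suc_iff)
    then obtain q where q: "(\<lambda>n. p n x) \<longlonglongrightarrow> q" by (auto simp: convergent_def)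
    have p_le: "p n x \<le> q" for n
      by (rule incseq_le[OF incseq_SucI q]) (use p0 \<beta>_nonneg in \<open>simp add: p_Suc\<close>)
    obtain K where K: "\<And>n. norm (Y n x) \<le> K"
      using elim(2) convergent_imp_Bseq BseqE by (metis (no_types, lifting))
    have S_le: "S n x \<le> K" for n
    proof -
      have "S n x \<le> Y n x" using V_nonneg[of n x] p0[of n x] by (simp add: Y_def)
      also have "\<dots> \<le> K" using K[of n] by simp
      finally show ?thesis .
    qed
    have sumS: "summable (\<lambda>k. \<nu> k x / p (Suc k) x)"
    proof (rule bounded_imp_summable)
      show "0 \<le> \<nu> k x / p (Suc k) x" for k by (intro divide_nonneg_pos \<nu>_nonneg p0)
      show "(\<Sum>k\<le>n. \<nu> k x / p (Suc k) x) \<le> K" for n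
        using S_le[of "Suc n"] by (simp add: S_def lessThan_Suc_atMost)
    qed
    then have "convergent (\<lambda>n. S n x)" by (simp add: summable_iff_convergent S_def)
    then have "convergent (\<lambda>n. (Y n x - S n x) * p n x - 1)"
      by (intro convergent_diff convergent_mult convergent_const elim pconv)
    moreover have "(Y n x - S n x) * p n x - 1 = V n x" for n
      using p0[of n x] by (simp add: Y_def)
    ultimately have "convergent (\<lambda>n. V n x)" by simp
    moreover have "summable (\<lambda>n. \<nu> n x)"
    proof (rule summable_comparison_test)
      show "summable (\<lambda>n. q * (\<nu> n x / p (Suc n) x))" by (rule summable_mult[OF sumS])
      have "norm (\<nu> n x) \<le> q * (\<nu> n x / p (Suc n) x)" for n
        using mult_right_mono[OF p_le[of "Suc n"] \<nu>_nonneg[of n x]] p0[of "Suc n" x] \<nu>_nonneg[of n x]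
        by (simp add: field_simps)
      then show "\<exists>N. \<forall>n\<ge>N. norm (\<nu> n x) \<le> q * (\<nu> n x / p (Suc n) x)" by blast
    qed
    ultimately show ?case by blast
  qed
qed

section \<open>Measurability of the inverse matrix\<close>

lemma borel_measurable_vec_nth [measurable (raw)]:
  fixes g :: "'a \<Rightarrow> 'b::euclidean_space ^ 'n"
  assumes "g \<in> borel_measurable M"
  shows "(\<lambda>x. g x $ i) \<in> borel_measurable M"
  by (rule borel_measurable_continuous_on[OF _ assms]) (intro continuous_intros)

lemma borel_measurable_vec_lambda:
  fixes g :: "'a \<Rightarrow> real ^ 'n"
  assumes "\<And>i. (\<lambda>x. g x $ i) \<in> borel_measurable M"
  shows "g \<in> borel_measurable M"
  using assms by (subst borel_measurable_euclidean_space) (auto simp: Basis_vec_def inner_axis)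

lemma borel_measurable_det:
  fixes A :: "'a \<Rightarrow> real ^ 'n ^ 'n"
  assumes "\<And>i j. (\<lambda>x. A x $ i $ j) \<in> borel_measurable M"
  shows "(\<lambda>x. det (A x)) \<in> borel_measurable M"
  unfolding det_def by (intro borel_measurable_sum borel_measurable_times borel_measurable_prod assms) auto

text \<open>
  Cramer's rule is used as a formula for the inverse matrix that shows that the inverse depends
  measurably on the matrix.
\<close>

lemma matrix_inv_mult_vec_cramer:
  fixes A :: "real ^ 'n ^ 'n"
  assumes "det A \<noteq> 0"
  shows "matrix_inv A *v v = (\<chi> k. det (\<chi> i j. if j = k then v $ i else A $ i $ j) / det A)"
proof -
  have "invertible A" using assms by (simp add: invertible_det_nz)
  then have "A ** matrix_inv A = mat 1" unfolding invertible_def matrix_inv_def by (metis (mono_tags, lifting) someI_ex)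
  then have "A *v (matrix_inv A *v v) = v" by (simp add: matrix_vector_mul_assoc)
  then show ?thesis using cramer[OF assms] by blast
qed

text \<open>
  On singular matrices the choice operator inside \<open>matrix_inv\<close> ranges over an empty predicate, so its
  value is one fixed matrix and measurability extends to all matrices.
\<close>

lemma matrix_inv_singular:
  fixes A :: "real ^ 'n ^ 'n"
  assumes "det A = 0"
  shows "matrix_inv A = (SOME A'. False)"
proof -
  have "\<not> invertible A" using assms by (simp add: invertible_det_nz)
  then have "(\<lambda>A'. A ** A' = mat 1 \<and> A' ** A = mat 1) = (\<lambda>_. False)" by (auto simp: invertible_def)
  then show ?thesis unfolding matrix_inv_def by (rule arg_cong)
qed

lemma borel_measurable_matrix_inv_mult_vec [measurable (raw)]:
  fixes A :: "'a \<Rightarrow> real ^ 'n ^ 'n" and v :: "'a \<Rightarrow> real ^ 'n"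
  assumes [measurable]: "A \<in> borel_measurable M" "v \<in> borel_measurable M"
  shows "(\<lambda>x. matrix_inv (A x) *v v x) \<in> borel_measurable M"
proof (rule borel_measurable_vec_lambda)
  fix k
  have [measurable]: "(\<lambda>x. det (A x)) \<in> borel_measurable M"
    "(\<lambda>x. det (\<chi> i j. if j = k then v x $ i else A x $ i $ j)) \<in> borel_measurable M"
    using assms by (auto intro!: borel_measurable_det simp: if_distrib cong: if_cong)
  have "(\<lambda>x. (matrix_inv (A x) *v v x) $ k) = (\<lambda>x. if det (A x) = 0 then ((SOME A'. False) *v v x) $ k
      else det (\<chi> i j. if j = k then v x $ i else A x $ i $ j) / det (A x))"
    using assms by (auto simp: matrix_inv_singular matrix_inv_mult_vec_cramer)
  also have "\<dots> \<in> borel_measurable M"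
    by (rule measurable_If) (auto simp: matrix_vector_mult_def)
  finally show "(\<lambda>x. (matrix_inv (A x) *v v x) $ k) \<in> borel_measurable M" .
qed

section \<open>Conditional expectations given the observations\<close>

lemma space_obs_filtration [simp]: "space (obs_filtration \<Omega> \<mu> X t) = \<Omega>"
  unfolding obs_filtration_def by (rule space_measure_of) auto

lemma sets_obs_filtration:
  "sets (obs_filtration \<Omega> \<mu> X t) = sigma_sets \<Omega> (\<Union>i\<in>{1..t}. {X i -` A \<inter> \<Omega> | A. A \<in> sets \<mu>})"
  unfolding obs_filtration_def by (rule sets_measure_of) auto

lemma obs_filtration_mono:
  "sets (obs_filtration \<Omega> \<mu> X t) \<subseteq> sets (obs_filtration \<Omega> \<mu> X (Suc t))"
  unfolding sets_obs_filtration by (rule sigma_sets_mono') (rule UN_mono, auto)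

lemma history_Suc: "history X (Suc t) \<omega> = (history X t \<omega>)(Suc t := X (Suc t) \<omega>)"
  by (auto simp: history_def fun_eq_iff)

context observation_model
begin

abbreviation Hist :: "nat \<Rightarrow> (nat \<Rightarrow> 'x) measure"
  where "Hist t \<equiv> Pi\<^sub>M {1..t} (\<lambda>_. \<mu>)"

abbreviation \<F> :: "real ^ 'm \<Rightarrow> nat \<Rightarrow> 'w measure"
  where "\<F> \<theta> t \<equiv> obs_filtration (space (P \<theta>)) \<mu> X t"

lemma subalgebra_obs_filtration: "subalgebra (P \<theta>) (\<F> \<theta> t)"
proof -
  have "sets (\<F> \<theta> t) \<subseteq> sets (P \<theta>)"
    unfolding sets_obs_filtration
    by (rule sets.sigma_sets_subset) (auto intro!: measurable_sets[OF measurable_X])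
  then show ?thesis by (simp add: subalgebra_def)
qed

lemma measurable_obs:
  assumes "i \<in> {1..t}"
  shows "X i \<in> \<F> \<theta> t \<rightarrow>\<^sub>M \<mu>"
proof (rule measurableI)
  show "X i \<omega> \<in> space \<mu>" if "\<omega> \<in> space (\<F> \<theta> t)" for \<omega>
    using measurable_space[OF measurable_X[of i \<theta>]] that assms by auto
  show "X i -` A \<inter> space (\<F> \<theta> t) \<in> sets (\<F> \<theta> t)" if "A \<in> sets \<mu>" for A
    unfolding sets_obs_filtration space_obs_filtration
    using that assms by (intro sigma_sets.Basic UN_I[of i]) auto
qed

lemma measurable_history: "history X t \<in> \<F> \<theta> t \<rightarrow>\<^sub>M Hist t"
  unfolding history_def by (rule measurable_restrict) (rule measurable_obs)

text \<open>
  The events observable up to time \<open>t\<close> are exactly the preimages of measurable sets of histories.  So an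
  event of the filtration can be tested on the law of the history.
\<close>

lemma sets_obs_filtration_eq_vimage:
  "sets (\<F> \<theta> t) = sets (vimage_algebra (space (P \<theta>)) (history X t) (Hist t))"
proof
  let ?V = "vimage_algebra (space (P \<theta>)) (history X t) (Hist t)"
  have hs: "history X t \<in> space (P \<theta>) \<rightarrow> space (Hist t)"
    using measurable_space[OF measurable_history[of t \<theta>]] by auto
  have gen: "X i -` A \<inter> space (P \<theta>) \<in> sets ?V" if i: "i \<in> {1..t}" and A: "A \<in> sets \<mu>" for i A
  proof -
    have "(\<lambda>h. h i) -` A \<inter> space (Hist t) \<in> sets (Hist t)"
      by (rule measurable_sets[OF measurable_component_singleton[OF i] A])
    then have "history X t -` ((\<lambda>h. h i) -` A \<inter> space (Hist t)) \<inter> space (P \<theta>) \<in> sets ?V"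
      by (rule in_vimage_algebra)
    also have "history X t -` ((\<lambda>h. h i) -` A \<inter> space (Hist t)) \<inter> space (P \<theta>) = X i -` A \<inter> space (P \<theta>)"
      using hs i by (auto simp: history_def)
    finally show ?thesis .
  qed
  show "sets (\<F> \<theta> t) \<subseteq> sets ?V"
    unfolding sets_obs_filtration
    using sets.sigma_sets_subset[of "\<Union>i\<in>{1..t}. {X i -` A \<inter> space (P \<theta>) |A. A \<in> sets \<mu>}" ?V] gen
    by fastforce
  show "sets ?V \<subseteq> sets (\<F> \<theta> t)"
    using measurable_sets[OF measurable_history[of t \<theta>]] hs by (auto simp: sets_vimage_algebra2)
qed

lemma measurable_history_P [measurable]: "history X t \<in> P \<theta> \<rightarrow>\<^sub>M Hist t"
  by (rule measurable_from_subalg[OF subalgebra_obs_filtration measurable_history])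

lemma measurable_extend_history [measurable]:
  "(\<lambda>(z, h). h(Suc t := z)) \<in> \<mu> \<Otimes>\<^sub>M Hist t \<rightarrow>\<^sub>M Hist (Suc t)"
proof -
  have "(\<lambda>(f, y). f(Suc t := y)) \<circ> (\<lambda>(z, h). (h, z)) \<in> \<mu> \<Otimes>\<^sub>M Hist t \<rightarrow>\<^sub>M Pi\<^sub>M (insert (Suc t) {1..t}) (\<lambda>_. \<mu>)"
    by (rule measurable_comp[OF measurable_pair_swap' measurable_add_dim])
  also have "insert (Suc t) {1..t} = {1..Suc t}" by auto
  finally show ?thesis 
    by (rule back_subst[where P = "\<lambda>g. g \<in> \<mu> \<Otimes>\<^sub>M Hist t \<rightarrow>\<^sub>M Hist (Suc t)"]) (auto simp: fun_eq_iff)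
qed

text \<open>
  On a rectangle the identity is the defining property of the conditional density, integrated over
  the event that the history lies in the second side.  Rectangles generate the product
  sigma-algebra and are closed under intersection, so the two measures agree.
\<close>

lemma distr_next_obs:
  "distr (P \<theta>) (\<mu> \<Otimes>\<^sub>M Hist t) (\<lambda>\<omega>. (X (Suc t) \<omega>, history X t \<omega>))
    = density (\<mu> \<Otimes>\<^sub>M distr (P \<theta>) (Hist t) (history X t)) (\<lambda>(z, h). ennreal (f (Suc t) \<theta> z h))"
    (is "?L = density (\<mu> \<Otimes>\<^sub>M ?Q) ?f")
proof -
  interpret P: prob_space "P \<theta>" by (rule prob_space_P)
  interpret mu: sigma_finite_measure \<mu> by (rule sigma_finite_mu)
  interpret Q: prob_space ?Q by (rule P.prob_space_distr) measurable
  interpret PS: pair_sigma_finite \<mu> ?Q ..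
  interpret S: finite_measure_subalgebra "P \<theta>" "\<F> \<theta> t"
    by unfold_locales (rule subalgebra_obs_filtration)
  have X[measurable]: "X (Suc t) \<in> P \<theta> \<rightarrow>\<^sub>M \<mu>" by (rule measurable_X) simp
  have f[measurable]: "(\<lambda>(z, h). f (Suc t) \<theta> z h) \<in> borel_measurable (\<mu> \<Otimes>\<^sub>M Hist t)"
    using measurable_density[of "Suc t" \<theta>] by simp
  have f0: "0 \<le> f (Suc t) \<theta> z h" if "z \<in> space \<mu>" "h \<in> space (Hist t)" for z h
    using density_nonneg[where t = "Suc t"] that by simp
  have f1: "(\<integral>\<^sup>+z. ennreal (f (Suc t) \<theta> z h) \<partial>\<mu>) = 1" if "h \<in> space (Hist t)" for h
    using density_total[of "Suc t"] that by simp
  have hs: "history X t \<omega> \<in> space (Hist t)" if "\<omega> \<in> space (P \<theta>)" for \<omega>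
    using measurable_space[OF measurable_history_P] that by blast
  have rect: "emeasure ?L (A \<times> C) = emeasure (density (\<mu> \<Otimes>\<^sub>M ?Q) ?f) (A \<times> C)"
    if A[measurable]: "A \<in> sets \<mu>" and C[measurable]: "C \<in> sets (Hist t)" for A C
  proof -
    let ?A = "X (Suc t) -` A \<inter> space (P \<theta>)" and ?C = "history X t -` C \<inter> space (P \<theta>)"
    have CF: "?C \<in> sets (\<F> \<theta> t)"
      using measurable_sets[OF measurable_history C] by simp
    have AM: "?A \<in> sets (P \<theta>)" and CM: "?C \<in> sets (P \<theta>)" by measurable
    have iA: "integrable (P \<theta>) (indicator ?A :: 'w \<Rightarrow> real)"
      using P.emeasure_finite[of ?A] by (intro integrable_real_indicator AM) (simp add: less_top[symmetric])
    let ?g = "\<lambda>\<omega>. LINT z:A|\<mu>. f (Suc t) \<theta> z (history X t \<omega>)"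
    have g: "ennreal (?g \<omega>) = (\<integral>\<^sup>+z\<in>A. ennreal (f (Suc t) \<theta> z (history X t \<omega>)) \<partial>\<mu>)" and g0: "0 \<le> ?g \<omega>"
      if "\<omega> \<in> space (P \<theta>)" for \<omega>
    proof -
      have fm: "(\<lambda>z. f (Suc t) \<theta> z (history X t \<omega>)) \<in> borel_measurable \<mu>"
        using measurable_Pair1[OF f hs[OF that]] by simp
      have nn: "0 \<le> indicator A z * f (Suc t) \<theta> z (history X t \<omega>)" if "z \<in> space \<mu>" for z
        using f0[OF that hs] \<open>\<omega> \<in> space (P \<theta>)\<close> by simp
      have "integrable \<mu> (\<lambda>z. f (Suc t) \<theta> z (history X t \<omega>))"
      proof (rule integrableI_nonneg)
        show "AE z in \<mu>. 0 \<le> f (Suc t) \<theta> z (history X t \<omega>)" using f0 hs[OF that] by (intro AE_I2) blast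
        show "(\<integral>\<^sup>+z. ennreal (f (Suc t) \<theta> z (history X t \<omega>)) \<partial>\<mu>) < \<infinity>"
          unfolding f1[OF hs[OF that]] by simp
      qed (rule fm)
      then have "integrable \<mu> (\<lambda>z. indicator A z * f (Suc t) \<theta> z (history X t \<omega>))"
        using integrable_mult_indicator[OF A, of "\<lambda>z. f (Suc t) \<theta> z (history X t \<omega>)"]
        by (simp only: real_scaleR_def)
      then have "(\<integral>\<^sup>+z. ennreal (indicator A z * f (Suc t) \<theta> z (history X t \<omega>)) \<partial>\<mu>) = ennreal (?g \<omega>)"
        unfolding set_lebesgue_integral_def real_scaleR_def
        by (rule nn_integral_eq_integral) (rule AE_I2, rule nn)
      then have "ennreal (?g \<omega>) = (\<integral>\<^sup>+z. ennreal (indicator A z * f (Suc t) \<theta> z (history X t \<omega>)) \<partial>\<mu>)" ..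
      also have "\<dots> = (\<integral>\<^sup>+z\<in>A. ennreal (f (Suc t) \<theta> z (history X t \<omega>)) \<partial>\<mu>)"
        by (rule nn_integral_cong) (auto simp: indicator_def)
      finally show "ennreal (?g \<omega>) = (\<integral>\<^sup>+z\<in>A. ennreal (f (Suc t) \<theta> z (history X t \<omega>)) \<partial>\<mu>)" .
      show "0 \<le> ?g \<omega>" unfolding set_lebesgue_integral_def real_scaleR_def
        by (rule Bochner_Integration.integral_nonneg) (rule nn)
    qed
    let ?E = "real_cond_exp (P \<theta>) (\<F> \<theta> t) (indicator ?A)"
    have E: "AE \<omega> in P \<theta>. ?E \<omega> = ?g \<omega>"
      using density_cond_prob[of "Suc t" A \<theta>] by simp
    have iE: "integrable (P \<theta>) ?E" by (rule S.real_cond_exp_int(1)[OF iA])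
    have "emeasure ?L (A \<times> C) = emeasure (P \<theta>) (?A \<inter> ?C)"
    proof -
      have "(\<lambda>\<omega>. (X (Suc t) \<omega>, history X t \<omega>)) -` (A \<times> C) \<inter> space (P \<theta>) = ?A \<inter> ?C" by auto
      moreover have "(\<lambda>\<omega>. (X (Suc t) \<omega>, history X t \<omega>)) \<in> P \<theta> \<rightarrow>\<^sub>M \<mu> \<Otimes>\<^sub>M Hist t" by measurable
      ultimately show ?thesis using pair_measureI[OF A C] by (simp only: emeasure_distr)
    qed
    also have "\<dots> = ennreal (\<integral>\<omega>. indicator ?C \<omega> * indicator ?A \<omega> \<partial>P \<theta>)"
      by (simp add: P.emeasure_eq_measure indicator_inter_arith[symmetric] Int_commute)
    also have "(\<integral>\<omega>. indicator ?C \<omega> * indicator ?A \<omega> \<partial>P \<theta>) = (\<integral>\<omega>. indicator ?C \<omega> * ?E \<omega> \<partial>P \<theta>)"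
      using S.real_cond_exp_intA[OF iA CF]
      by (simp add: set_lebesgue_integral_def)
    also have "ennreal \<dots> = (\<integral>\<^sup>+\<omega>. ennreal (indicator ?C \<omega> * ?E \<omega>) \<partial>P \<theta>)"
    proof (rule nn_integral_eq_integral[symmetric])
      show "integrable (P \<theta>) (\<lambda>\<omega>. indicator ?C \<omega> * ?E \<omega>)"
        using integrable_mult_indicator[OF CM iE] by (simp only: real_scaleR_def)
      show "AE \<omega> in P \<theta>. 0 \<le> indicator ?C \<omega> * ?E \<omega>"
        using E AE_space by eventually_elim (simp add: g0)
    qed
    also have "\<dots> = (\<integral>\<^sup>+\<omega>. (\<integral>\<^sup>+z. ?f (z, history X t \<omega>) * indicator (A \<times> C) (z, history X t \<omega>) \<partial>\<mu>) \<partial>P \<theta>)"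
    proof (rule nn_integral_cong_AE)
      show "AE \<omega> in P \<theta>. ennreal (indicator ?C \<omega> * ?E \<omega>)
          = (\<integral>\<^sup>+z. ?f (z, history X t \<omega>) * indicator (A \<times> C) (z, history X t \<omega>) \<partial>\<mu>)"
        using E AE_space by eventually_elim (auto simp: indicator_times g split: split_indicator)
    qed
    also have "\<dots> = (\<integral>\<^sup>+h. (\<integral>\<^sup>+z. ?f (z, h) * indicator (A \<times> C) (z, h) \<partial>\<mu>) \<partial>?Q)"
      by (subst nn_integral_distr) measurable
    also have "\<dots> = (\<integral>\<^sup>+x. ?f x * indicator (A \<times> C) x \<partial>(\<mu> \<Otimes>\<^sub>M ?Q))"
      by (rule PS.nn_integral_snd) measurable
    also have "\<dots> = emeasure (density (\<mu> \<Otimes>\<^sub>M ?Q) ?f) (A \<times> C)"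
      by (rule emeasure_density[symmetric]) measurable
    finally show ?thesis .
  qed
  let ?G = "{A \<times> C | A C. A \<in> sets \<mu> \<and> C \<in> sets (Hist t)}"
  interpret L: prob_space ?L by (rule P.prob_space_distr) measurable
  show ?thesis
  proof (rule measure_eqI_generator_eq[where \<Omega> = "space \<mu> \<times> space (Hist t)" and E = ?G
        and A = "\<lambda>_. space \<mu> \<times> space (Hist t)"])
    show "Int_stable ?G" by (rule Int_stable_pair_measure_generator)
    show "?G \<subseteq> Pow (space \<mu> \<times> space (Hist t))" by (auto dest: sets.sets_into_space)
    show "emeasure ?L Z = emeasure (density (\<mu> \<Otimes>\<^sub>M ?Q) ?f) Z" if "Z \<in> ?G" for Z
      using that rect by auto
    show "sets ?L = sigma_sets (space \<mu> \<times> space (Hist t)) ?G" by (simp add: sets_pair_measure)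
    show "sets (density (\<mu> \<Otimes>\<^sub>M ?Q) ?f) = sigma_sets (space \<mu> \<times> space (Hist t)) ?G"
      by (simp add: sets_pair_measure)
    show "emeasure ?L (space \<mu> \<times> space (Hist t)) \<noteq> \<infinity>" using L.emeasure_finite by simp
  qed auto
qed

text \<open>
  Tested on an observable event, both sides are integrals over the joint law of the next observation and
  the history, where Fubini's theorem separates the two.  This connects conditions stated with
  densities to the supermartingale argument.
\<close>

lemma nn_cond_exp_next_obs:
  assumes \<phi>[measurable]: "\<phi> \<in> borel_measurable (Hist (Suc t))"
  shows "AE \<omega> in P \<theta>. nn_cond_exp (P \<theta>) (\<F> \<theta> t) (\<lambda>\<omega>. \<phi> (history X (Suc t) \<omega>)) \<omega>
    = (\<integral>\<^sup>+z. ennreal (f (Suc t) \<theta> z (history X t \<omega>)) * \<phi> ((history X t \<omega>)(Suc t := z)) \<partial>\<mu>)"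
proof -
  interpret P: prob_space "P \<theta>" by (rule prob_space_P)
  interpret mu: sigma_finite_measure \<mu> by (rule sigma_finite_mu)
  let ?Q = "distr (P \<theta>) (Hist t) (history X t)"
  interpret Q: prob_space ?Q by (rule P.prob_space_distr) measurable
  interpret PS: pair_sigma_finite \<mu> ?Q ..
  interpret S: finite_measure_subalgebra "P \<theta>" "\<F> \<theta> t"
    by unfold_locales (rule subalgebra_obs_filtration)
  have X[measurable]: "X (Suc t) \<in> P \<theta> \<rightarrow>\<^sub>M \<mu>" by (rule measurable_X) simp
  have f[measurable]: "(\<lambda>(z, h). f (Suc t) \<theta> z h) \<in> borel_measurable (\<mu> \<Otimes>\<^sub>M Hist t)"
    using measurable_density[of "Suc t" \<theta>] by simp
  have \<phi>2[measurable]: "(\<lambda>(z, h). \<phi> (h(Suc t := z))) \<in> borel_measurable (\<mu> \<Otimes>\<^sub>M Hist t)"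
    using measurable_compose[OF measurable_extend_history \<phi>] by (simp add: case_prod_beta')
  let ?k = "\<lambda>h. \<integral>\<^sup>+z. ennreal (f (Suc t) \<theta> z h) * \<phi> (h(Suc t := z)) \<partial>\<mu>"
  have k[measurable]: "?k \<in> borel_measurable (Hist t)" by measurable
  have "AE \<omega> in P \<theta>. ?k (history X t \<omega>)
      = nn_cond_exp (P \<theta>) (\<F> \<theta> t) (\<lambda>\<omega>. \<phi> (history X (Suc t) \<omega>)) \<omega>"
  proof (rule S.nn_cond_exp_charact)
    show "(\<lambda>\<omega>. ?k (history X t \<omega>)) \<in> borel_measurable (\<F> \<theta> t)"
      by (rule measurable_compose[OF measurable_history k])
    show "(\<lambda>\<omega>. \<phi> (history X (Suc t) \<omega>)) \<in> borel_measurable (P \<theta>)" by measurable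
    fix D assume D: "D \<in> sets (\<F> \<theta> t)"
    obtain C where C[measurable]: "C \<in> sets (Hist t)" and DC: "D = history X t -` C \<inter> space (P \<theta>)"
      using D sets_obs_filtration_eq_vimage[of \<theta> t] sets_vimage_algebra2[of "history X t" "space (P \<theta>)" "Hist t"]
        measurable_space[OF measurable_history_P[of t \<theta>]] by auto
    show "(\<integral>\<^sup>+\<omega>\<in>D. \<phi> (history X (Suc t) \<omega>) \<partial>P \<theta>) = (\<integral>\<^sup>+\<omega>\<in>D. ?k (history X t \<omega>) \<partial>P \<theta>)"
    proof -
      have m: "(\<lambda>x. (\<lambda>(z, h). ennreal (f (Suc t) \<theta> z h)) x
          * (\<lambda>(z, h). \<phi> (h(Suc t := z)) * indicator C h) x) \<in> borel_measurable (\<mu> \<Otimes>\<^sub>M ?Q)"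
        by measurable
      have "(\<integral>\<^sup>+\<omega>\<in>D. \<phi> (history X (Suc t) \<omega>) \<partial>P \<theta>)
          = (\<integral>\<^sup>+\<omega>. (\<lambda>(z, h). \<phi> (h(Suc t := z)) * indicator C h) (X (Suc t) \<omega>, history X t \<omega>) \<partial>P \<theta>)"
        by (rule nn_integral_cong) (simp add: DC history_Suc indicator_def)
      also have "\<dots> = (\<integral>\<^sup>+x. (\<lambda>(z, h). \<phi> (h(Suc t := z)) * indicator C h) x
          \<partial>distr (P \<theta>) (\<mu> \<Otimes>\<^sub>M Hist t) (\<lambda>\<omega>. (X (Suc t) \<omega>, history X t \<omega>)))"
        by (subst nn_integral_distr) measurable
      also have "\<dots> = (\<integral>\<^sup>+x. (\<lambda>(z, h). ennreal (f (Suc t) \<theta> z h)) x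
          * (\<lambda>(z, h). \<phi> (h(Suc t := z)) * indicator C h) x \<partial>(\<mu> \<Otimes>\<^sub>M ?Q))"
        unfolding distr_next_obs by (rule nn_integral_density) measurable
      also have "\<dots> = (\<integral>\<^sup>+h. (\<integral>\<^sup>+z. ennreal (f (Suc t) \<theta> z h) * (\<phi> (h(Suc t := z)) * indicator C h) \<partial>\<mu>) \<partial>?Q)"
        using PS.nn_integral_snd[OF m] by (simp add: case_prod_beta')
      also have "\<dots> = (\<integral>\<^sup>+h. ?k h * indicator C h \<partial>?Q)"
        by (rule nn_integral_cong) (auto simp: indicator_def)
      also have "\<dots> = (\<integral>\<^sup>+\<omega>. ?k (history X t \<omega>) * indicator C (history X t \<omega>) \<partial>P \<theta>)"
        by (rule nn_integral_distr) measurable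
      also have "\<dots> = (\<integral>\<^sup>+\<omega>\<in>D. ?k (history X t \<omega>) \<partial>P \<theta>)"
        by (rule nn_integral_cong) (simp add: DC indicator_def)
      finally show ?thesis .
    qed
  qed
  then show ?thesis by eventually_elim simp
qed

end

section \<open>Stochastic approximation\<close>

text \<open>
  A positive limit of \<open>norm (u n)\<close> would keep \<open>u n\<close> in one of the shells eventually; there the drift
  dominates its infimum over the shell, and the infima would be summable.  The shells are indexed by
  \<open>\<epsilon> = 1 / (k + 2)\<close>, with radii \<open>\<epsilon>\<close> and \<open>1 / \<epsilon>\<close>: countably many of them exhaust the complement of the
  origin, so the lemma can be used outside a single null set.
\<close>

lemma tendsto_zero_if_drift_summable:
  fixes u :: "nat \<Rightarrow> 'v::real_normed_vector" and d :: "nat \<Rightarrow> 'v \<Rightarrow> real"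
  assumes conv: "convergent (\<lambda>n. (norm (u n))\<^sup>2)"
    and sum: "summable (\<lambda>n. d n (u n))"
    and nonneg: "\<And>n v. 0 \<le> d n v"
    and div: "\<And>k::nat. (\<Sum>n. ennreal (INF v\<in>{v. 1 / real (k + 2) \<le> norm v \<and> norm v \<le> 1 / (1 / real (k + 2))}. d n v)) = \<infinity>"
  shows "u \<longlonglongrightarrow> 0"
proof -
  obtain l where "(\<lambda>n. (norm (u n))\<^sup>2) \<longlonglongrightarrow> l" using conv by (auto simp: convergent_def)
  then have "(\<lambda>n. sqrt ((norm (u n))\<^sup>2)) \<longlonglongrightarrow> sqrt l" by (rule tendsto_real_sqrt)
  then have lim: "(\<lambda>n. norm (u n)) \<longlonglongrightarrow> sqrt l" by simp
  then have l0: "0 \<le> sqrt l" by (rule LIMSEQ_le_const) auto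
  have "sqrt l = 0"
  proof (rule ccontr)
    assume "sqrt l \<noteq> 0"
    then have pos: "0 < sqrt l" using l0 by simp
    \<comment> \<open>This k makes the shell contain the limit in its interior, on both sides.\<close>
    obtain k :: nat where k: "sqrt l + 1 / sqrt l < real k" using reals_Archimedean2 by blast
    let ?\<epsilon> = "1 / real (k + 2)"
    have "1 / sqrt l < real (k + 2)" using k pos by linarith
    then have lo: "?\<epsilon> < sqrt l" using pos by (simp add: field_simps)
    have "0 < 1 / sqrt l" using pos by simp
    then have "sqrt l < real (k + 2)" using k by linarith
    then have hi: "sqrt l < 1 / ?\<epsilon>" by simp
    let ?S = "{v::'v. ?\<epsilon> \<le> norm v \<and> norm v \<le> 1 / ?\<epsilon>}"
    have "\<forall>\<^sub>F n in sequentially. u n \<in> ?S"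
      using order_tendstoD(1)[OF lim lo] order_tendstoD(2)[OF lim hi] by eventually_elim auto
    then obtain N where N: "\<And>n. n \<ge> N \<Longrightarrow> u n \<in> ?S" by (auto simp: eventually_sequentially)
    let ?I = "\<lambda>n. INF v\<in>?S. d n v"
    have I0: "0 \<le> ?I n" for n
      using N[of N] by (intro cINF_greatest nonneg) auto
    have "?I n \<le> d n (u n)" if "n \<ge> N" for n
      by (rule cINF_lower[OF _ N[OF that]]) (rule bdd_belowI2[of _ 0], rule nonneg)
    then have "summable ?I"
      using I0 by (intro summable_comparison_test'[OF sum, of N]) auto
    then have "(\<Sum>n. ennreal (?I n)) \<noteq> \<infinity>"
      using I0 by (subst suminf_ennreal2) auto
    then show False using div[of k] by blast
  qed
  with lim show ?thesis by (simp add: tendsto_norm_zero_iff)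
qed

text \<open>
  The second moment of a random vector with density \<open>w\<close>, shifted by \<open>u\<close>.  The nonnegativity of the
  right hand side is recorded because \<open>ennreal\<close> truncates negative reals to \<open>0\<close>, so that it does not
  follow from the equation.
\<close>

lemma nn_integral_norm_square_shift:
  fixes G :: "'x \<Rightarrow> 'v::euclidean_space" and w :: "'x \<Rightarrow> real"
  assumes w[measurable]: "w \<in> borel_measurable M" and w0: "\<And>z. z \<in> space M \<Longrightarrow> 0 \<le> w z"
    and w1: "(\<integral>\<^sup>+z. ennreal (w z) \<partial>M) = 1"
    and G: "integrable M (\<lambda>z. w z *\<^sub>R G z)"
    and G2: "integrable M (\<lambda>z. w z *\<^sub>R (norm (G z))\<^sup>2)"
  shows "(\<integral>\<^sup>+z. ennreal (w z) * ennreal ((norm (u + G z))\<^sup>2) \<partial>M)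
    = ennreal ((norm u)\<^sup>2 + 2 * (u \<bullet> (\<integral>z. w z *\<^sub>R G z \<partial>M)) + (\<integral>z. w z *\<^sub>R (norm (G z))\<^sup>2 \<partial>M))"
    (is ?eq)
    and "0 \<le> (norm u)\<^sup>2 + 2 * (u \<bullet> (\<integral>z. w z *\<^sub>R G z \<partial>M)) + (\<integral>z. w z *\<^sub>R (norm (G z))\<^sup>2 \<partial>M)"
    (is "0 \<le> ?r")
proof -
  have iw: "integrable M w"
    by (rule integrableI_nonneg) (auto intro!: AE_I2 w0 simp: w1)
  have "ennreal (\<integral>z. w z \<partial>M) = ennreal 1"
    using nn_integral_eq_integral[OF iw] w0 w1 by simp
  then have w1': "(\<integral>z. w z \<partial>M) = 1"
    using Bochner_Integration.integral_nonneg[of M w] w0 by (simp add: ennreal_inj del: ennreal_1)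
  have iwu: "integrable M (\<lambda>z. (norm u)\<^sup>2 * w z)" by (rule integrable_mult_right[OF iw])
  have iGu: "integrable M (\<lambda>z. 2 * (u \<bullet> (w z *\<^sub>R G z)))"
    by (rule integrable_mult_right[OF integrable_inner_right[OF G]])
  have eq: "w z * (norm (u + G z))\<^sup>2
      = (norm u)\<^sup>2 * w z + 2 * (u \<bullet> (w z *\<^sub>R G z)) + w z *\<^sub>R (norm (G z))\<^sup>2" for z
    by (simp add: power2_norm_eq_inner inner_add_left inner_add_right inner_commute algebra_simps)
  have i: "integrable M (\<lambda>z. w z * (norm (u + G z))\<^sup>2)"
    unfolding eq by (intro Bochner_Integration.integrable_add iwu iGu G2)
  have "(\<integral>\<^sup>+z. ennreal (w z) * ennreal ((norm (u + G z))\<^sup>2) \<partial>M) = (\<integral>\<^sup>+z. ennreal (w z * (norm (u + G z))\<^sup>2) \<partial>M)"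
    by (rule nn_integral_cong) (simp add: ennreal_mult' w0)
  also have "\<dots> = ennreal (\<integral>z. w z * (norm (u + G z))\<^sup>2 \<partial>M)"
    by (rule nn_integral_eq_integral[OF i]) (auto intro!: AE_I2 mult_nonneg_nonneg w0)
  also have int_eq: "(\<integral>z. w z * (norm (u + G z))\<^sup>2 \<partial>M) = ?r"
  proof -
    have "(\<integral>z. w z * (norm (u + G z))\<^sup>2 \<partial>M)
        = (\<integral>z. (norm u)\<^sup>2 * w z \<partial>M) + (\<integral>z. 2 * (u \<bullet> (w z *\<^sub>R G z)) \<partial>M) + (\<integral>z. w z *\<^sub>R (norm (G z))\<^sup>2 \<partial>M)"
      unfolding eq
      by (simp only: Bochner_Integration.integral_add Bochner_Integration.integrable_add iwu iGu G2)
    also have "(\<integral>z. 2 * (u \<bullet> (w z *\<^sub>R G z)) \<partial>M) = 2 * (u \<bullet> (\<integral>z. w z *\<^sub>R G z \<partial>M))"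
      using integral_inner_right[OF G, of u] by simp
    finally show ?thesis by (simp add: w1')
  qed
  finally show ?eq .
  have "0 \<le> (\<integral>z. w z * (norm (u + G z))\<^sup>2 \<partial>M)"
    by (rule Bochner_Integration.integral_nonneg) (simp add: w0)
  then show "0 \<le> ?r" unfolding int_eq .
qed

text \<open>
  The recursion as a function of the observed history rather than of the sample point.  This is the form
  in which the next observation can be integrated out against its conditional density.
\<close>

primrec iterate :: "(nat \<Rightarrow> 'v \<Rightarrow> (nat \<Rightarrow> 'x) \<Rightarrow> 'v) \<Rightarrow> 'v \<Rightarrow> nat \<Rightarrow> (nat \<Rightarrow> 'x) \<Rightarrow> 'v::plus" where
  "iterate g v\<^sub>0 0 h = v\<^sub>0"
| "iterate g v\<^sub>0 (Suc t) h =
    (let v = iterate g v\<^sub>0 t (restrict h {1..t}) in v + g (Suc t) v h)"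

lemma restrict_history: "s \<le> t \<Longrightarrow> restrict (history X t \<omega>) {1..s} = history X s \<omega>"
  by (auto simp: history_def restrict_def fun_eq_iff)

lemma restrict_history_upd: "restrict ((history X t \<omega>)(Suc t := z)) {1..t} = history X t \<omega>"
  by (auto simp: history_def restrict_def fun_eq_iff)

lemma iterate_history:
  assumes "e 0 = v\<^sub>0" and "\<And>t. e (Suc t) = e t + g (Suc t) (e t) (history X (Suc t) \<omega>)"
  shows "iterate g v\<^sub>0 t (history X t \<omega>) = e t"
  by (induction t) (simp_all add: assms restrict_history Let_def del: One_nat_def)

lemma measurable_iterate:
  fixes g :: "nat \<Rightarrow> 'v::euclidean_space \<Rightarrow> (nat \<Rightarrow> 'x) \<Rightarrow> 'v"
  assumes g: "\<And>t. (\<lambda>(v, h). g (Suc t) v h) \<in> borel_measurable (borel \<Otimes>\<^sub>M Pi\<^sub>M {1..Suc t} (\<lambda>_. \<mu>))"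
  shows "iterate g v\<^sub>0 t \<in> borel_measurable (Pi\<^sub>M {1..t} (\<lambda>_. \<mu>))"
proof (induction t)
  case (Suc t)
  have r: "(\<lambda>h. restrict h {1..t}) \<in> Pi\<^sub>M {1..Suc t} (\<lambda>_. \<mu>) \<rightarrow>\<^sub>M Pi\<^sub>M {1..t} (\<lambda>_. \<mu>)"
    by (rule measurable_restrict_subset) auto
  have v: "(\<lambda>h. iterate g v\<^sub>0 t (restrict h {1..t})) \<in> borel_measurable (Pi\<^sub>M {1..Suc t} (\<lambda>_. \<mu>))"
    by (rule measurable_compose[OF r Suc])
  have "(\<lambda>h. g (Suc t) (iterate g v\<^sub>0 t (restrict h {1..t})) h) \<in> borel_measurable (Pi\<^sub>M {1..Suc t} (\<lambda>_. \<mu>))"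
    using measurable_compose[OF measurable_Pair[OF v measurable_ident] g] by simp
  with v show ?case unfolding iterate.simps Let_def by (rule borel_measurable_add)
qed simp

context observation_model
begin

text \<open>
  The conditional mean of the squared error after one more step.  Evaluating the conditional mean at the
  random point \<open>u = e t \<omega> - \<theta>\<close> is legitimate because the exceptional null sets do not depend on \<open>u\<close>.
\<close>

lemma nn_cond_exp_square_iterate:
  fixes g :: "nat \<Rightarrow> real ^ 'm \<Rightarrow> (nat \<Rightarrow> 'x) \<Rightarrow> real ^ 'm" and e :: "nat \<Rightarrow> 'w \<Rightarrow> real ^ 'm"
  assumes g: "\<And>t. (\<lambda>(v, h). g (Suc t) v h) \<in> borel_measurable (borel \<Otimes>\<^sub>M Hist (Suc t))"
    and e_iterate: "\<And>t \<omega>. \<omega> \<in> space (P \<theta>) \<Longrightarrow> e t \<omega> = iterate g v\<^sub>0 t (history X t \<omega>)"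
    and mean_defined: "AE \<omega> in P \<theta>. \<forall>u. cond_E_defined \<mu> f X \<theta> (Suc t) (g (Suc t) (\<theta> + u)) \<omega>"
    and square_defined: "AE \<omega> in P \<theta>. \<forall>u. cond_E_defined \<mu> f X \<theta> (Suc t) (\<lambda>x. (norm (g (Suc t) (\<theta> + u) x))\<^sup>2) \<omega>"
  defines "q \<equiv> \<lambda>\<omega>. (norm (e t \<omega> - \<theta>))\<^sup>2
      + 2 * ((e t \<omega> - \<theta>) \<bullet> cond_E \<mu> f X \<theta> (Suc t) (g (Suc t) (e t \<omega>)) \<omega>)
      + cond_E \<mu> f X \<theta> (Suc t) (\<lambda>x. (norm (g (Suc t) (e t \<omega>) x))\<^sup>2) \<omega>"
  shows "AE \<omega> in P \<theta>. 0 \<le> q \<omega> \<and>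
    nn_cond_exp (P \<theta>) (\<F> \<theta> t) (\<lambda>\<omega>. ennreal ((norm (e (Suc t) \<omega> - \<theta>))\<^sup>2)) \<omega> = ennreal (q \<omega>)"
proof -
  let ?e = "iterate g v\<^sub>0"
  have [measurable]: "?e t \<in> borel_measurable (Hist t)" for t
    by (rule measurable_iterate[OF g])
  have f[measurable]: "(\<lambda>(z, h). f (Suc t) \<theta> z h) \<in> borel_measurable (\<mu> \<Otimes>\<^sub>M Hist t)"
    using measurable_density[of "Suc t" \<theta>] by simp
  have "AE \<omega> in P \<theta>. nn_cond_exp (P \<theta>) (\<F> \<theta> t)
      (\<lambda>\<omega>. ennreal ((norm (?e (Suc t) (history X (Suc t) \<omega>) - \<theta>))\<^sup>2)) \<omega>
    = (\<integral>\<^sup>+z. ennreal (f (Suc t) \<theta> z (history X t \<omega>))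
        * ennreal ((norm (?e (Suc t) ((history X t \<omega>)(Suc t := z)) - \<theta>))\<^sup>2) \<partial>\<mu>)"
    by (rule nn_cond_exp_next_obs[where \<phi> = "\<lambda>h. ennreal ((norm (?e (Suc t) h - \<theta>))\<^sup>2)"]) measurable
  moreover have "AE \<omega> in P \<theta>. nn_cond_exp (P \<theta>) (\<F> \<theta> t)
      (\<lambda>\<omega>. ennreal ((norm (?e (Suc t) (history X (Suc t) \<omega>) - \<theta>))\<^sup>2)) \<omega>
    = nn_cond_exp (P \<theta>) (\<F> \<theta> t) (\<lambda>\<omega>. ennreal ((norm (e (Suc t) \<omega> - \<theta>))\<^sup>2)) \<omega>"
  proof -
    interpret P: prob_space "P \<theta>" by (rule prob_space_P)
    interpret S: finite_measure_subalgebra "P \<theta>" "\<F> \<theta> t"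
      by unfold_locales (rule subalgebra_obs_filtration)
    have m: "(\<lambda>\<omega>. ennreal ((norm (?e (Suc t) (history X (Suc t) \<omega>) - \<theta>))\<^sup>2)) \<in> borel_measurable (P \<theta>)"
      by measurable
    also have "?this \<longleftrightarrow> (\<lambda>\<omega>. ennreal ((norm (e (Suc t) \<omega> - \<theta>))\<^sup>2)) \<in> borel_measurable (P \<theta>)"
      by (rule measurable_cong) (simp add: e_iterate del: iterate.simps)
    finally show ?thesis using m
      by (intro S.nn_cond_exp_cong AE_I2) (simp_all add: e_iterate del: iterate.simps)
  qed
  ultimately show ?thesis using mean_defined square_defined AE_space
  proof eventually_elim
    case (elim \<omega>)
    let ?h = "history X t \<omega>"
    let ?w = "\<lambda>z. f (Suc t) \<theta> z ?h" and ?G = "\<lambda>z. g (Suc t) (e t \<omega>) (?h(Suc t := z))"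
    have h: "?h \<in> space (Hist t)" using measurable_space[OF measurable_history_P] elim(5) by blast
    have w: "?w \<in> borel_measurable \<mu>" using measurable_Pair1[OF f h] by simp
    have w0: "0 \<le> ?w z" if "z \<in> space \<mu>" for z using density_nonneg[where t = "Suc t"] that h by simp
    have w1: "(\<integral>\<^sup>+z. ennreal (?w z) \<partial>\<mu>) = 1" using density_total[where t = "Suc t"] h by simp
    have G: "integrable \<mu> (\<lambda>z. ?w z *\<^sub>R ?G z)"
      using spec[OF elim(3), of "e t \<omega> - \<theta>"] by (simp add: cond_E_defined_def)
    have G2: "integrable \<mu> (\<lambda>z. ?w z *\<^sub>R (norm (?G z))\<^sup>2)"
      using spec[OF elim(4), of "e t \<omega> - \<theta>"] by (simp add: cond_E_defined_def)
    have step: "?e (Suc t) (?h(Suc t := z)) - \<theta> = (e t \<omega> - \<theta>) + ?G z" for z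
      by (simp add: restrict_history_upd Let_def e_iterate[OF elim(5)] del: One_nat_def)
    show ?case
      using nn_integral_norm_square_shift[OF w w0 w1 G G2, of "e t \<omega> - \<theta>"] elim(1,2)
      unfolding step cond_E_def q_def by simp
  qed
qed

text \<open>
  Consistency of a general recursion whose increment \<open>g\<close> points towards \<open>\<theta>\<close> on average.
  The squared error satisfies the assumptions of the Robbins-Siegmund lemma, where \<open>\<nu>\<close> is twice the
  absolute value of the mean drift along the error.  So the error has a limiting norm and the drift
  evaluated along the error is summable; divergence of the infima on shells leaves only the limit \<open>0\<close>.
\<close>

theorem stochastic_approximation_consistent:
  fixes g :: "nat \<Rightarrow> real ^ 'm \<Rightarrow> (nat \<Rightarrow> 'x) \<Rightarrow> real ^ 'm" and e :: "nat \<Rightarrow> 'w \<Rightarrow> real ^ 'm"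
  assumes g: "\<And>t. (\<lambda>(v, h). g (Suc t) v h) \<in> borel_measurable (borel \<Otimes>\<^sub>M Hist (Suc t))"
    and init: "\<And>\<omega>. \<omega> \<in> space (P \<theta>) \<Longrightarrow> e 0 \<omega> = v\<^sub>0"
    and recursion: "\<And>t \<omega>. \<omega> \<in> space (P \<theta>) \<Longrightarrow>
      e (Suc t) \<omega> = e t \<omega> + g (Suc t) (e t \<omega>) (history X (Suc t) \<omega>)"
    and mean_defined: "\<And>t. AE \<omega> in P \<theta>. \<forall>u. cond_E_defined \<mu> f X \<theta> (Suc t) (g (Suc t) (\<theta> + u)) \<omega>"
    and square_defined: "\<And>t. AE \<omega> in P \<theta>. \<forall>u. cond_E_defined \<mu> f X \<theta> (Suc t) (\<lambda>x. (norm (g (Suc t) (\<theta> + u) x))\<^sup>2) \<omega>"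
    and towards: "\<And>t. AE \<omega> in P \<theta>. \<forall>u. u \<noteq> 0 \<longrightarrow>
      u \<bullet> cond_E \<mu> f X \<theta> (Suc t) (g (Suc t) (\<theta> + u)) \<omega> < 0"
    and divergent: "\<And>\<epsilon>::real. 0 < \<epsilon> \<Longrightarrow> \<epsilon> < 1 \<Longrightarrow> AE \<omega> in P \<theta>.
      (\<Sum>t. ennreal (INF u\<in>{u. \<epsilon> \<le> norm u \<and> norm u \<le> 1 / \<epsilon>}.
        \<bar>u \<bullet> cond_E \<mu> f X \<theta> (Suc t) (g (Suc t) (\<theta> + u)) \<omega>\<bar>)) = \<infinity>"
    and B_predictable: "\<And>t. B t \<in> borel_measurable (\<F> \<theta> t)"
    and B_bound: "\<And>t. AE \<omega> in P \<theta>. \<forall>u.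
      cond_E \<mu> f X \<theta> (Suc t) (\<lambda>x. (norm (g (Suc t) (\<theta> + u) x))\<^sup>2) \<omega> \<le> B t \<omega> * (1 + (norm u)\<^sup>2)"
    and B_summable: "AE \<omega> in P \<theta>. summable (\<lambda>t. B t \<omega>)"
  shows "AE \<omega> in P \<theta>. (\<lambda>t. e t \<omega>) \<longlonglongrightarrow> \<theta>"
proof -
  interpret P: prob_space "P \<theta>" by (rule prob_space_P)
  interpret mu: sigma_finite_measure \<mu> by (rule sigma_finite_mu)
  let ?e = "iterate g v\<^sub>0"
  have e_iterate: "e t \<omega> = ?e t (history X t \<omega>)" if "\<omega> \<in> space (P \<theta>)" for t \<omega>
    using iterate_history[of "\<lambda>t. e t \<omega>" v\<^sub>0 g X \<omega> t] init recursion that by simp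
  have eH[measurable]: "?e t \<in> borel_measurable (Hist t)" for t
    by (rule measurable_iterate[OF g])
  have eF[measurable]: "e t \<in> borel_measurable (\<F> \<theta> t)" for t
  proof -
    have "(\<lambda>\<omega>. ?e t (history X t \<omega>)) \<in> borel_measurable (\<F> \<theta> t)"
      by (rule measurable_compose[OF measurable_history eH])
    also have "?this \<longleftrightarrow> e t \<in> borel_measurable (\<F> \<theta> t)"
      by (rule measurable_cong) (simp add: e_iterate)
    finally show ?thesis .
  qed
  let ?m = "\<lambda>t \<omega>. cond_E \<mu> f X \<theta> (Suc t) (g (Suc t) (e t \<omega>)) \<omega>"
  have mF[measurable]: "?m t \<in> borel_measurable (\<F> \<theta> t)" for t
  proof -
    have f[measurable]: "(\<lambda>(z, h). f (Suc t) \<theta> z h) \<in> borel_measurable (\<mu> \<Otimes>\<^sub>M Hist t)"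
      using measurable_density[of "Suc t" \<theta>] by simp
    have ext: "(\<lambda>(h, z). h(Suc t := z)) \<in> Hist t \<Otimes>\<^sub>M \<mu> \<rightarrow>\<^sub>M Hist (Suc t)"
      using measurable_compose[OF measurable_pair_swap' measurable_extend_history] by (simp add: case_prod_beta')
    have v: "(\<lambda>(h, z). ?e t h) \<in> borel_measurable (Hist t \<Otimes>\<^sub>M \<mu>)" by measurable
    have G[measurable]: "(\<lambda>(h, z). g (Suc t) (?e t h) (h(Suc t := z))) \<in> borel_measurable (Hist t \<Otimes>\<^sub>M \<mu>)"
      using measurable_compose[OF measurable_Pair[OF v ext] g] by (simp add: case_prod_beta')
    have "(\<lambda>h. LINT z|\<mu>. f (Suc t) \<theta> z h *\<^sub>R g (Suc t) (?e t h) (h(Suc t := z))) \<in> borel_measurable (Hist t)"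
      by measurable
    then have "(\<lambda>\<omega>. LINT z|\<mu>. f (Suc t) \<theta> z (history X t \<omega>)
        *\<^sub>R g (Suc t) (?e t (history X t \<omega>)) ((history X t \<omega>)(Suc t := z))) \<in> borel_measurable (\<F> \<theta> t)"
      by (rule measurable_compose[OF measurable_history])
    also have "?this \<longleftrightarrow> ?m t \<in> borel_measurable (\<F> \<theta> t)"
      by (rule measurable_cong) (simp add: e_iterate cond_E_def)
    finally show ?thesis .
  qed
  define V where "V t \<omega> = (norm (e t \<omega> - \<theta>))\<^sup>2" for t \<omega>
  \<comment> \<open>The bound B is nonnegative only almost surely.\<close>
  define \<beta> where "\<beta> t \<omega> = max 0 (B t \<omega>)" for t \<omega>
  define \<nu> where "\<nu> t \<omega> = 2 * \<bar>(e t \<omega> - \<theta>) \<bullet> ?m t \<omega>\<bar>" for t \<omega>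
  let ?r = "\<lambda>t \<omega>. V t \<omega> + 2 * ((e t \<omega> - \<theta>) \<bullet> ?m t \<omega>)
    + cond_E \<mu> f X \<theta> (Suc t) (\<lambda>x. (norm (g (Suc t) (e t \<omega>) x))\<^sup>2) \<omega>"
  have "AE \<omega> in P \<theta>. convergent (\<lambda>t. V t \<omega>) \<and> summable (\<lambda>t. \<nu> t \<omega>)"
  proof (rule P.robbins_siegmund[where F = "\<F> \<theta>" and V = V and \<beta> = \<beta> and \<nu> = \<nu>])
    show "subalgebra (P \<theta>) (\<F> \<theta> t)" for t by (rule subalgebra_obs_filtration)
    show "sets (\<F> \<theta> t) \<subseteq> sets (\<F> \<theta> (Suc t))" for t by (rule obs_filtration_mono)
    show "V t \<in> borel_measurable (\<F> \<theta> t)" for t unfolding V_def by measurable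
    show "\<beta> t \<in> borel_measurable (\<F> \<theta> t)" for t
      using B_predictable[of t] unfolding \<beta>_def by measurable
    show "\<nu> t \<in> borel_measurable (\<F> \<theta> t)" for t
      using mF[of t] eF[of t] unfolding \<nu>_def by measurable
    show "0 \<le> V t \<omega>" "0 \<le> \<beta> t \<omega>" "0 \<le> \<nu> t \<omega>" for t \<omega> by (simp_all add: V_def \<beta>_def \<nu>_def)
    have "(\<integral>\<^sup>+\<omega>. ennreal (V 0 \<omega>) \<partial>P \<theta>) = (\<integral>\<^sup>+\<omega>. ennreal ((norm (v\<^sub>0 - \<theta>))\<^sup>2) \<partial>P \<theta>)"
      by (rule nn_integral_cong) (simp add: V_def init)
    then show "(\<integral>\<^sup>+\<omega>. ennreal (V 0 \<omega>) \<partial>P \<theta>) < \<infinity>" by (simp add: P.emeasure_space_1)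
    show "AE \<omega> in P \<theta>. summable (\<lambda>t. \<beta> t \<omega>)"
    proof -
      have "AE \<omega> in P \<theta>. \<forall>t u.
          cond_E \<mu> f X \<theta> (Suc t) (\<lambda>x. (norm (g (Suc t) (\<theta> + u) x))\<^sup>2) \<omega> \<le> B t \<omega> * (1 + (norm u)\<^sup>2)"
        unfolding AE_all_countable by (rule allI) (rule B_bound)
      with B_summable AE_space show ?thesis
      proof eventually_elim
        case (elim \<omega>)
        have "0 \<le> B t \<omega>" for t
        proof -
          have "0 \<le> cond_E \<mu> f X \<theta> (Suc t) (\<lambda>x. (norm (g (Suc t) (\<theta> + 0) x))\<^sup>2) \<omega>"
            unfolding cond_E_def
            using density_nonneg[where t = "Suc t"] measurable_space[OF measurable_history_P elim(2)]
            by (intro Bochner_Integration.integral_nonneg) simp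
          also have "\<dots> \<le> B t \<omega> * (1 + (norm (0 :: real ^ 'm))\<^sup>2)" using elim(3) by blast
          finally show ?thesis by simp
        qed
        then show ?case using elim(1) by (simp add: \<beta>_def max_absorb2)
      qed
    qed
    show "AE \<omega> in P \<theta>. nn_cond_exp (P \<theta>) (\<F> \<theta> t) (\<lambda>\<omega>. ennreal (V (Suc t) \<omega>)) \<omega> + ennreal (\<nu> t \<omega>)
        \<le> ennreal ((1 + \<beta> t \<omega>) * V t \<omega> + \<beta> t \<omega>)" for t
    proof -
      have "AE \<omega> in P \<theta>. 0 \<le> ?r t \<omega> \<and>
          nn_cond_exp (P \<theta>) (\<F> \<theta> t) (\<lambda>\<omega>. ennreal (V (Suc t) \<omega>)) \<omega> = ennreal (?r t \<omega>)"
        unfolding V_def using g e_iterate mean_defined square_defined by (rule nn_cond_exp_square_iterate)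
      with towards[of t] B_bound[of t] show ?thesis
      proof eventually_elim
        case (elim \<omega>)
        let ?u = "e t \<omega> - \<theta>"
        let ?s = "cond_E \<mu> f X \<theta> (Suc t) (\<lambda>x. (norm (g (Suc t) (e t \<omega>) x))\<^sup>2) \<omega>"
        have "?u \<bullet> ?m t \<omega> \<le> 0"
          using elim(1)[rule_format, of ?u] by (cases "?u = 0") auto
        then have \<nu>: "\<nu> t \<omega> = - 2 * (?u \<bullet> ?m t \<omega>)" by (simp add: \<nu>_def)
        have s: "?s \<le> \<beta> t \<omega> * (1 + V t \<omega>)"
        proof -
          have "?s \<le> B t \<omega> * (1 + V t \<omega>)"
            using elim(2)[rule_format, of ?u] by (simp add: V_def)
          also have "\<dots> \<le> \<beta> t \<omega> * (1 + V t \<omega>)"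
            by (rule mult_right_mono) (simp_all add: \<beta>_def V_def)
          finally show ?thesis .
        qed
        have s0: "0 \<le> V t \<omega> + 2 * (?u \<bullet> ?m t \<omega>) + ?s"
          using elim(3) by (simp add: V_def)
        have "nn_cond_exp (P \<theta>) (\<F> \<theta> t) (\<lambda>\<omega>. ennreal (V (Suc t) \<omega>)) \<omega> + ennreal (\<nu> t \<omega>)
            = ennreal (V t \<omega> + 2 * (?u \<bullet> ?m t \<omega>) + ?s) + ennreal (\<nu> t \<omega>)"
          using elim(3) by (simp add: V_def)
        also have "\<dots> = ennreal (V t \<omega> + ?s)"
          using s0 \<nu> by (subst ennreal_plus[symmetric]) (auto simp: \<nu>_def)
        also have "\<dots> \<le> ennreal ((1 + \<beta> t \<omega>) * V t \<omega> + \<beta> t \<omega>)"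
          using s by (intro ennreal_leI) (simp add: algebra_simps)
        finally show ?case .
      qed
    qed
  qed
  moreover have "AE \<omega> in P \<theta>. \<forall>k::nat.
      (\<Sum>t. ennreal (INF u\<in>{u. 1 / real (k + 2) \<le> norm u \<and> norm u \<le> 1 / (1 / real (k + 2))}.
        \<bar>u \<bullet> cond_E \<mu> f X \<theta> (Suc t) (g (Suc t) (\<theta> + u)) \<omega>\<bar>)) = \<infinity>"
    unfolding AE_all_countable by (intro allI divergent) simp_all
  ultimately show ?thesis
  proof eventually_elim
    case (elim \<omega>)
    have "(\<lambda>t. e t \<omega> - \<theta>) \<longlonglongrightarrow> 0"
    proof (rule tendsto_zero_if_drift_summable)
      show "convergent (\<lambda>t. (norm (e t \<omega> - \<theta>))\<^sup>2)" using elim(1) by (simp add: V_def)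
      show "summable (\<lambda>t. \<bar>(e t \<omega> - \<theta>) \<bullet> cond_E \<mu> f X \<theta> (Suc t) (g (Suc t) (\<theta> + (e t \<omega> - \<theta>))) \<omega>\<bar>)"
        using summable_mult[of "\<lambda>t. \<nu> t \<omega>" "1 / 2"] elim(1) by (simp add: \<nu>_def)
    qed (use elim(2) in auto)
    then show ?case by (simp add: LIM_zero_iff)
  qed
qed

end

section \<open>Consistency of the recursive estimator\<close>

theorem theorem3p1:
  fixes P :: "real ^ 'm \<Rightarrow> 'w measure"
    and X :: "nat \<Rightarrow> 'w \<Rightarrow> 'x"
    and \<mu> :: "'x measure"
    and f :: "nat \<Rightarrow> real ^ 'm \<Rightarrow> 'x \<Rightarrow> (nat \<Rightarrow> 'x) \<Rightarrow> real"
    and \<psi> :: "nat \<Rightarrow> real ^ 'm \<Rightarrow> (nat \<Rightarrow> 'x) \<Rightarrow> real ^ 'm"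
    and \<Gamma> :: "nat \<Rightarrow> real ^ 'm \<Rightarrow> (nat \<Rightarrow> 'x) \<Rightarrow> real ^ 'm ^ 'm"
    and \<theta> \<theta>\<^sub>0 :: "real ^ 'm"
    and \<theta>hat :: "nat \<Rightarrow> 'w \<Rightarrow> real ^ 'm"
    and b :: "nat \<Rightarrow> real ^ 'm \<Rightarrow> 'w \<Rightarrow> real ^ 'm"
    and B :: "nat \<Rightarrow> 'w \<Rightarrow> real"
  assumes model: "observation_model P X \<mu> f"
    and psi_borel: "\<And>t. t \<ge> 1 \<Longrightarrow>
      (\<lambda>(v, h). \<psi> t v h) \<in> borel_measurable (borel \<Otimes>\<^sub>M Pi\<^sub>M {1..t} (\<lambda>_. \<mu>))"
    and Gamma_borel: "\<And>t. t \<ge> 1 \<Longrightarrow>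
      (\<lambda>(v, h). \<Gamma> t v h) \<in> borel_measurable (borel \<Otimes>\<^sub>M Pi\<^sub>M {1..t - 1} (\<lambda>_. \<mu>))"
    and Gamma_det: "\<And>t v \<omega>. t \<ge> 1 \<Longrightarrow> \<omega> \<in> space (P \<theta>) \<Longrightarrow>
      det (\<Gamma> t v (history X (t - 1) \<omega>)) \<noteq> 0"
    and init: "\<And>\<omega>. \<omega> \<in> space (P \<theta>) \<Longrightarrow> \<theta>hat 0 \<omega> = \<theta>\<^sub>0"
    and recursion: "\<And>t \<omega>. t \<ge> 1 \<Longrightarrow> \<omega> \<in> space (P \<theta>) \<Longrightarrow>
      \<theta>hat t \<omega> = \<theta>hat (t - 1) \<omega>
        + matrix_inv (\<Gamma> t (\<theta>hat (t - 1) \<omega>) (history X (t - 1) \<omega>))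
            *v \<psi> t (\<theta>hat (t - 1) \<omega>) (history X t \<omega>)"
    and b_eq: "\<And>t u \<omega>. t \<ge> 1 \<Longrightarrow> \<omega> \<in> space (P \<theta>) \<Longrightarrow>
      b t u \<omega> = cond_E \<mu> f X \<theta> t (\<psi> t (\<theta> + u)) \<omega>"
    and b_defined: "\<And>t. t \<ge> 1 \<Longrightarrow>
      AE \<omega> in P \<theta>. \<forall>u. cond_E_defined \<mu> f X \<theta> t (\<psi> t (\<theta> + u)) \<omega>"
    and C1: "\<And>t. t \<ge> 1 \<Longrightarrow>
      AE \<omega> in P \<theta>. \<forall>u. u \<noteq> 0 \<longrightarrow>
        u \<bullet> (matrix_inv (\<Gamma> t (\<theta> + u) (history X (t - 1) \<omega>)) *v b t u \<omega>) < 0"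
    and C2: "\<And>\<epsilon>::real. 0 < \<epsilon> \<Longrightarrow> \<epsilon> < 1 \<Longrightarrow>
      AE \<omega> in P \<theta>.
        (\<Sum>t. ennreal (INF u\<in>{u. \<epsilon> \<le> norm u \<and> norm u \<le> 1 / \<epsilon>}.
          \<bar>u \<bullet> (matrix_inv (\<Gamma> (Suc t) (\<theta> + u) (history X t \<omega>)) *v b (Suc t) u \<omega>)\<bar>)) = \<infinity>"
    and B_predictable: "\<And>t. t \<ge> 1 \<Longrightarrow>
      B t \<in> borel_measurable (obs_filtration (space (P \<theta>)) \<mu> X (t - 1))"
    and C3_defined: "\<And>t. t \<ge> 1 \<Longrightarrow>
      AE \<omega> in P \<theta>. \<forall>u. cond_E_defined \<mu> f X \<theta> t
        (\<lambda>x. (norm (matrix_inv (\<Gamma> t (\<theta> + u) (restrict x {1..t - 1})) *v \<psi> t (\<theta> + u) x))\<^sup>2) \<omega>"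
    and C3_bound: "\<And>t. t \<ge> 1 \<Longrightarrow>
      AE \<omega> in P \<theta>. \<forall>u. cond_E \<mu> f X \<theta> t
        (\<lambda>x. (norm (matrix_inv (\<Gamma> t (\<theta> + u) (restrict x {1..t - 1})) *v \<psi> t (\<theta> + u) x))\<^sup>2) \<omega>
        \<le> B t \<omega> * (1 + (norm u)\<^sup>2)"
    and C3_sum: "AE \<omega> in P \<theta>. summable (\<lambda>t. B (Suc t) \<omega>)"
  shows "AE \<omega> in P \<theta>. (\<lambda>t. \<theta>hat t \<omega>) \<longlonglongrightarrow> \<theta>"
proof -
  interpret observation_model P X \<mu> f by (rule model)
  define g where "g t v h = matrix_inv (\<Gamma> t v (restrict h {1..t - 1})) *v \<psi> t v h" for t v h
  have g: "(\<lambda>(v, h). g (Suc t) v h) \<in> borel_measurable (borel \<Otimes>\<^sub>M Hist (Suc t))" for t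
  proof -
    have r: "(\<lambda>h. restrict h {1..t}) \<in> Hist (Suc t) \<rightarrow>\<^sub>M Hist t"
      by (rule measurable_restrict_subset) auto
    have "(\<lambda>(v, h). (v, restrict h {1..t})) \<in> borel \<Otimes>\<^sub>M Hist (Suc t) \<rightarrow>\<^sub>M borel \<Otimes>\<^sub>M Hist t"
      using r by measurable
    from measurable_compose[OF this Gamma_borel[of "Suc t", simplified diff_Suc_1]]
    have G: "(\<lambda>(v, h). \<Gamma> (Suc t) v (restrict h {1..t})) \<in> borel_measurable (borel \<Otimes>\<^sub>M Hist (Suc t))"
      by (simp add: case_prod_beta')
    show ?thesis
      using borel_measurable_matrix_inv_mult_vec[OF G psi_borel[of "Suc t"]]
      by (simp add: g_def case_prod_beta')
  qed
  \<comment> \<open>Given the past, the gain matrix is constant and may be pulled out of the conditional mean.\<close>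
  have mean: "cond_E_defined \<mu> f X \<theta> (Suc t) (g (Suc t) (\<theta> + u)) \<omega>"
      "cond_E \<mu> f X \<theta> (Suc t) (g (Suc t) (\<theta> + u)) \<omega>
        = matrix_inv (\<Gamma> (Suc t) (\<theta> + u) (history X t \<omega>)) *v b (Suc t) u \<omega>"
    if "\<omega> \<in> space (P \<theta>)" "cond_E_defined \<mu> f X \<theta> (Suc t) (\<psi> (Suc t) (\<theta> + u)) \<omega>" for t u \<omega>
  proof -
    let ?A = "matrix_inv (\<Gamma> (Suc t) (\<theta> + u) (history X t \<omega>))"
    let ?h = "\<lambda>z. (history X t \<omega>)(Suc t := z)"
    have eq: "f (Suc t) \<theta> z (history X t \<omega>) *\<^sub>R g (Suc t) (\<theta> + u) (?h z)
        = ?A *v (f (Suc t) \<theta> z (history X t \<omega>) *\<^sub>R \<psi> (Suc t) (\<theta> + u) (?h z))" for z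
      by (simp add: g_def restrict_history_upd matrix_vector_mult_scaleR del: One_nat_def)
    have i: "integrable \<mu> (\<lambda>z. f (Suc t) \<theta> z (history X t \<omega>) *\<^sub>R \<psi> (Suc t) (\<theta> + u) (?h z))"
      using that(2) by (simp add: cond_E_defined_def)
    show "cond_E_defined \<mu> f X \<theta> (Suc t) (g (Suc t) (\<theta> + u)) \<omega>"
      unfolding cond_E_defined_def diff_Suc_1 eq
      by (rule integrable_bounded_linear[OF matrix_vector_mul_bounded_linear i])
    show "cond_E \<mu> f X \<theta> (Suc t) (g (Suc t) (\<theta> + u)) \<omega> = ?A *v b (Suc t) u \<omega>"
      using integral_bounded_linear[OF matrix_vector_mul_bounded_linear[of ?A] i] b_eq[of "Suc t" \<omega> u] that(1)
      by (simp add: cond_E_def eq)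
  qed
  have b_def: "AE \<omega> in P \<theta>. \<omega> \<in> space (P \<theta>) \<and> (\<forall>t u. cond_E_defined \<mu> f X \<theta> (Suc t) (\<psi> (Suc t) (\<theta> + u)) \<omega>)"
    unfolding AE_conj_iff AE_all_countable by (auto intro: b_defined)
  show ?thesis
  proof (rule stochastic_approximation_consistent[where g = g and B = "\<lambda>t. B (Suc t)"])
    show "\<theta>hat 0 \<omega> = \<theta>\<^sub>0" if "\<omega> \<in> space (P \<theta>)" for \<omega> using init that .
    show "\<theta>hat (Suc t) \<omega> = \<theta>hat t \<omega> + g (Suc t) (\<theta>hat t \<omega>) (history X (Suc t) \<omega>)"
      if "\<omega> \<in> space (P \<theta>)" for t \<omega>
      using recursion[of "Suc t" \<omega>] that by (simp add: g_def restrict_history del: One_nat_def)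
    show "AE \<omega> in P \<theta>. \<forall>u. cond_E_defined \<mu> f X \<theta> (Suc t) (g (Suc t) (\<theta> + u)) \<omega>" for t
      using b_def by eventually_elim (use mean(1) in blast)
    show "AE \<omega> in P \<theta>. \<forall>u. u \<noteq> 0 \<longrightarrow> u \<bullet> cond_E \<mu> f X \<theta> (Suc t) (g (Suc t) (\<theta> + u)) \<omega> < 0" for t
      using b_def C1[of "Suc t", OF le_add1[of 1 t, unfolded plus_1_eq_Suc]]
      by eventually_elim (simp add: mean(2))
    show "AE \<omega> in P \<theta>. (\<Sum>t. ennreal (INF u\<in>{u. \<epsilon> \<le> norm u \<and> norm u \<le> 1 / \<epsilon>}.
        \<bar>u \<bullet> cond_E \<mu> f X \<theta> (Suc t) (g (Suc t) (\<theta> + u)) \<omega>\<bar>)) = \<infinity>" if "0 < \<epsilon>" "\<epsilon> < 1" for \<epsilon> :: real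
      using b_def C2[OF that] by eventually_elim (simp add: mean(2))
    show "B (Suc t) \<in> borel_measurable (\<F> \<theta> t)" for t using B_predictable[of "Suc t"] by simp
    show "AE \<omega> in P \<theta>. summable (\<lambda>t. B (Suc t) \<omega>)" by (rule C3_sum)
    show "AE \<omega> in P \<theta>. \<forall>u. cond_E_defined \<mu> f X \<theta> (Suc t) (\<lambda>x. (norm (g (Suc t) (\<theta> + u) x))\<^sup>2) \<omega>" for t
      unfolding g_def by (rule C3_defined) simp
    show "AE \<omega> in P \<theta>. \<forall>u. cond_E \<mu> f X \<theta> (Suc t) (\<lambda>x. (norm (g (Suc t) (\<theta> + u) x))\<^sup>2) \<omega>
        \<le> B (Suc t) \<omega> * (1 + (norm u)\<^sup>2)" for t
      unfolding g_def by (rule C3_bound) simp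
  qed (rule g)
qed

end
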